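(* Let $K$ be a field. There is a unique $K$-bilinear map $$\sqcup\!\sqcup : K\{x\}_\infty \times K\{x\}_\infty \to K\{x\}_\infty$$ such that for any $S,T\in\mathbf{PRT}'$ the value $\sqcup\!\sqcup(S,T)$ is the planar shuffle product $$S \sqcup\!\sqcup T := \sum_{V\in\mathbf{PRT}'} \sharp N_{S,T}(V)\cdot V$$ of $S$ and $T$. Moreover, $\sqcup\!\sqcup$ is commutative and associative.
   Context: A finite planar rooted tree is a (nonempty) finite tree $T$ with a root $\rho_T$ and a linear (left-to-right) order on the set of children of each vertex. The arity of a vertex is the number of its children. $T$ is reduced if no vertex has arity $1$. $\mathbf{PRT}$ is the set of isomorphism classes of finite planar reduced rooted trees, $\mathbf{PRT}'=\{1\}\,\dot\cup\,\mathbf{PRT}$ with $1$ the empty tree, and $x\in\mathbf{PRT}$ is the tree with a single vertex. $L(T)$ is the set of leaves (vertices of arity $0$) of $T$ ($L(1)=\emptyset$), and $\deg(T)=\sharp L(T)$. $K\{x\}_\infty$, the space of planar tree polynomials over $K$, is the $K$-vector space with basis $\mathbf{PRT}'$. Reduction: for vertices $a,b$ of a finite planar rooted tree $T$, $[a,b]_T$ denotes the simple path between $a$ and $b$. $\mathrm{Red}(T)$ is the planar reduced rooted tree whose vertices are the vertices of $T$ of arity $\neq 1$, whose edges are the pairs $\{a,b\}$ of distinct such vertices for which $[a,b]_T$ contains no vertex of arity $\ne1$ other than $a,b$, whose root is the vertex of arity $\neq1$ closest to $\rho_T$, and whose left-to-right orders are induced from $T$. Contraction: for $I\subseteq L(T)$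 let $T_I:=\bigcup_{a\in I}[a,\rho_T]_T$, a planar rooted tree with root $\rho_T$ (empty if $I=\emptyset$), and $T|I:=\mathrm{Red}(T_I)$, with $T|\emptyset=1$. For $S,T,V\in\mathbf{PRT}'$, $N_{S,T}(V):=\{I\subseteq L(V): V|I=S,\ V|I^c=T\}$ with $I^c:=L(V)-I$. (It is empty if $\deg V\neq\deg S+\deg T$, so the sum defining $S\sqcup\!\sqcup T$ is finite.) $\sharp$ denotes cardinality. *)

theory Defs
  imports Complex_Main "HOL-Library.Poly_Mapping"
begin

section \<open>Planar rooted trees on an arbitrary vertex set\<close>

text \<open>
  The field \<open>left_of\<close> holds the left-to-right orders of all sets of siblings, as one strict relation.
\<close>

record 'v planar_tree =
  vertices :: "'v set"
  edges :: "'v set set"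
  root_of :: 'v
  left_of :: "('v \<times> 'v) set"

definition simple_path :: "'v planar_tree \<Rightarrow> 'v \<Rightarrow> 'v \<Rightarrow> 'v list \<Rightarrow> bool" where
  "simple_path T a b ps \<longleftrightarrow> ps \<noteq> [] \<and> hd ps = a \<and> last ps = b \<and> distinct ps \<and>
     set ps \<subseteq> vertices T \<and> successively (\<lambda>u v. {u, v} \<in> edges T) ps"

text \<open>
  The vertex set of \<open>[a, b]\<^sub>T\<close>. In a tree there is exactly one simple path from \<open>a\<close> to \<open>b\<close>.
\<close>

definition path :: "'v planar_tree \<Rightarrow> 'v \<Rightarrow> 'v \<Rightarrow> 'v set" where
  "path T a b = {v. \<exists>ps. simple_path T a b ps \<and> v \<in> set ps}"

definition children :: "'v planar_tree \<Rightarrow> 'v \<Rightarrow> 'v set" where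
  "children T v = {w \<in> vertices T. w \<noteq> v \<and> {v, w} \<in> edges T \<and> v \<in> path T w (root_of T)}"

definition arity :: "'v planar_tree \<Rightarrow> 'v \<Rightarrow> nat" where
  "arity T v = card (children T v)"

definition leaves :: "'v planar_tree \<Rightarrow> 'v set" where
  "leaves T = {v \<in> vertices T. arity T v = 0}"

definition reduced :: "'v planar_tree \<Rightarrow> bool" where
  "reduced T \<longleftrightarrow> (\<forall>v \<in> vertices T. arity T v \<noteq> 1)"

definition planar_iso :: "'v planar_tree \<Rightarrow> 'w planar_tree \<Rightarrow> bool" where
  "planar_iso S T \<longleftrightarrow> (\<exists>f. bij_betw f (vertices S) (vertices T) \<and>
     f (root_of S) = root_of T \<and>
     (\<forall>u \<in> vertices S. \<forall>v \<in> vertices S.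
        ({u, v} \<in> edges S \<longleftrightarrow> {f u, f v} \<in> edges T) \<and>
        ((u, v) \<in> left_of S \<longleftrightarrow> (f u, f v) \<in> left_of T)))"

text \<open>
  The tree \<open>T\<^sub>I\<close>, the union of the paths \<open>[a, \<rho>\<^sub>T]\<^sub>T\<close> for \<open>a \<in> I\<close>; it is only used for \<open>I \<noteq> {}\<close>.
  An edge of \<open>T\<close> with both ends in this union lies on one of the paths.
\<close>

definition span_tree :: "'v planar_tree \<Rightarrow> 'v set \<Rightarrow> 'v planar_tree" where
  "span_tree T I = (let W = (\<Union>a \<in> I. path T a (root_of T)) in
     \<lparr>vertices = W,
      edges = {e \<in> edges T. e \<subseteq> W},
      root_of = root_of T,
      left_of = left_of T \<inter> W \<times> W\<rparr>)"

text \<open>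
  Reduction. Two children \<open>a\<close>, \<open>b\<close> of a vertex \<open>c\<close> of the reduced tree are ordered like the children
  \<open>u\<close>, \<open>v\<close> of \<open>c\<close> in \<open>T\<close> through which the paths from \<open>c\<close> to \<open>a\<close> and \<open>b\<close> start.
\<close>

definition red_vertices :: "'v planar_tree \<Rightarrow> 'v set" where
  "red_vertices T = {v \<in> vertices T. arity T v \<noteq> 1}"

definition red_edges :: "'v planar_tree \<Rightarrow> 'v set set" where
  "red_edges T = {{a, b} | a b. a \<in> red_vertices T \<and> b \<in> red_vertices T \<and> a \<noteq> b \<and>
     path T a b \<inter> red_vertices T \<subseteq> {a, b}}"

definition Red :: "'v planar_tree \<Rightarrow> 'v planar_tree" where
  "Red T =
     \<lparr>vertices = red_vertices T,
      edges = red_edges T,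
      root_of = arg_min (\<lambda>v. card (path T (root_of T) v)) (\<lambda>v. v \<in> red_vertices T),
      left_of = {(a, b). \<exists>c u v. {c, a} \<in> red_edges T \<and> {c, b} \<in> red_edges T \<and>
        u \<in> children T c \<and> u \<in> path T c a \<and> v \<in> children T c \<and> v \<in> path T c b \<and>
        (u, v) \<in> left_of T}\<rparr>"


section \<open>Isomorphism classes\<close>

text \<open>
  Every finite planar rooted tree is isomorphic to \<open>tree_of T\<close> for exactly one \<open>T :: ptree\<close>, so this
  type represents the isomorphism classes. A vertex of \<open>tree_of T\<close> is the list of the
  positions (counted from 0 on the left) of the children chosen on the way down from the root.
\<close>

datatype ptree = Node "ptree list"

fun is_vertex :: "ptree \<Rightarrow> nat list \<Rightarrow> bool" where
  "is_vertex T [] \<longleftrightarrow> True"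
| "is_vertex (Node Ts) (i # p) \<longleftrightarrow> i < length Ts \<and> is_vertex (Ts ! i) p"

definition tree_of :: "ptree \<Rightarrow> nat list planar_tree" where
  "tree_of T =
     \<lparr>vertices = {p. is_vertex T p},
      edges = {{p, p @ [i]} | p i. is_vertex T (p @ [i])},
      root_of = [],
      left_of = {(p @ [i], p @ [j]) | p i j. is_vertex T (p @ [i]) \<and> is_vertex T (p @ [j]) \<and> i < j}\<rparr>"

lemma is_vertex_single: "is_vertex (Node []) p \<longleftrightarrow> p = []"
  by (cases p) auto

typedef prt = "{T. reduced (tree_of T)}"
  morphisms ptree_of_prt Abs_prt
proof
  show "Node [] \<in> {T. reduced (tree_of T)}"
    by (auto simp: reduced_def arity_def children_def tree_of_def is_vertex_single)
qed

text \<open>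
  \<open>PRT'\<close> is \<open>prt option\<close>, with \<open>None\<close> the empty tree \<open>1\<close>.
\<close>

fun leaves' :: "prt option \<Rightarrow> nat list set" where
  "leaves' None = {}"
| "leaves' (Some T) = leaves (tree_of (ptree_of_prt T))"

text \<open>
  The contraction \<open>T|I\<close>, defined for \<open>I \<subseteq> leaves' T\<close>.
\<close>

fun contract :: "prt option \<Rightarrow> nat list set \<Rightarrow> prt option" where
  "contract None I = None"
| "contract (Some T) I = (if I = {} then None else
     Some (THE S. planar_iso (tree_of (ptree_of_prt S)) (Red (span_tree (tree_of (ptree_of_prt T)) I))))"

definition N :: "prt option \<Rightarrow> prt option \<Rightarrow> prt option \<Rightarrow> nat list set set" where
  "N S T V = {I. I \<subseteq> leaves' V \<and> contract V I = S \<and> contract V (leaves' V - I) = T}"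


section \<open>Planar tree polynomials\<close>

type_synonym 'k tree_poly = "prt option \<Rightarrow>\<^sub>0 'k"

definition scale :: "'k::field \<Rightarrow> 'k tree_poly \<Rightarrow> 'k tree_poly" where
  "scale c f = Poly_Mapping.map ((*) c) f"

lemma lookup_scale [simp]: "Poly_Mapping.lookup (scale c f) V = c * Poly_Mapping.lookup f V"
  by (simp add: scale_def map.rep_eq when_def)

lemma vector_space_scale: "vector_space (scale :: 'k::field \<Rightarrow> 'k tree_poly \<Rightarrow> 'k tree_poly)"
  by standard (auto intro!: poly_mapping_eqI simp: lookup_add algebra_simps)

definition tree_basis :: "prt option \<Rightarrow> 'k::field tree_poly" where
  "tree_basis V = Poly_Mapping.single V 1"

definition bilinear_map :: "('k::field tree_poly \<Rightarrow> 'k tree_poly \<Rightarrow> 'k tree_poly) \<Rightarrow> bool" where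
  "bilinear_map B \<longleftrightarrow>
     (\<forall>f. Vector_Spaces.linear scale scale (\<lambda>g. B f g)) \<and>
     (\<forall>g. Vector_Spaces.linear scale scale (\<lambda>f. B f g))"

text \<open>
  \<open>Sum_any\<close> is the sum over all of \<open>PRT'\<close>; only finitely many summands are nonzero.
\<close>

definition planar_shuffle :: "prt option \<Rightarrow> prt option \<Rightarrow> 'k::field tree_poly" where
  "planar_shuffle S T = Sum_any (\<lambda>V. scale (of_nat (card (N S T V))) (tree_basis V))"

end

theory Submission
  imports Defs "HOL-Library.Sublist"
begin

text \<open>
  A vertex of \<open>tree_of T\<close> is a list, and ancestry is the prefix order. For leaves \<open>I\<close> of \<open>T\<close> the
  vertices of \<open>T\<^sub>I\<close> of arity other than 1 are the longest common prefixes of elements of \<open>I\<close>, so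
  \<open>T|I\<close> is determined by \<open>I\<close> as a set of lists: it is the tree of covering pairs of this set of
  meets. Meets are preserved by isomorphisms of prefix-ordered sets, hence \<open>(T|I)|J = T|J\<close> once the
  leaves of \<open>T|I\<close> are identified with \<open>I\<close>. The coefficient of \<open>W\<close> in \<open>(S \<squnion> T) \<squnion> U\<close> therefore
  counts the ordered partitions of the leaves of \<open>W\<close> into three sets with contractions \<open>S\<close>, \<open>T\<close>,
  \<open>U\<close>. This count is invariant under rotation of \<open>S\<close>, \<open>T\<close>, \<open>U\<close>, which together with commutativity
  gives associativity.
\<close>

section \<open>Longest common prefixes\<close>

text \<open>Contraction is a definite description over isomorphism classes, so every identity
  between contractions needs an existence and a rigidity argument: some reduced tree must be
  isomorphic to the reduction, and at most one can be. Moreover, iterated contraction replaces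
  \<open>T|I\<close> by an abstract representative before contracting again, while a planar
  isomorphism speaks only of edges and siblings. The family \<open>cover_tree X\<close> resolves
  this: it contains \<open>tree_of T\<close> (with \<open>X\<close> prefix-closed) and every
  reduction (with \<open>X = meets I\<close>), and maps that preserve \<open>prefix\<close> and
  \<open>leftp\<close> on all pairs restrict to subsets and commute with meets. Paths are computed
  once, for prefix-closed sets; everything after the reduction is pure order theory. With rotation
  only one bracketing has to be counted: \<open>(f g) h = (g h) f = f (g h)\<close>. The shuffle
  sums are finite because degrees add and because in a reduced tree every proper branch has strictly
  fewer leaves, which leaves finitely many trees of bounded degree.\<close>

abbreviation lcp :: "'a list \<Rightarrow> 'a list \<Rightarrow> 'a list" where
  "lcp \<equiv> longest_common_prefix"

text \<open>The universal property of the meet in the prefix order; with \<open>prefix_ext\<close>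
  it turns identities between meets into propositional ones.\<close>

lemma prefix_lcp_iff: "prefix c (lcp a b) \<longleftrightarrow> prefix c a \<and> prefix c b"
  by (meson longest_common_prefix_max_prefix longest_common_prefix_prefix1
      longest_common_prefix_prefix2 prefix_order.trans)

lemma lcp_eqI:
  assumes "prefix c a" "prefix c b" "\<And>d. prefix d a \<Longrightarrow> prefix d b \<Longrightarrow> prefix d c"
  shows "lcp a b = c"
  by (meson assms prefix_lcp_iff prefix_order.antisym prefix_order.refl)

lemma lcp_absorb1: "prefix a b \<Longrightarrow> lcp a b = a"
  by (intro lcp_eqI) auto

lemma lcp_absorb2: "prefix b a \<Longrightarrow> lcp a b = b"
  by (intro lcp_eqI) auto

text \<open>A common prefix properly extending \<open>c\<close> would have to continue with both
  \<open>i\<close> and \<open>j\<close>.\<close>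

lemma lcp_diverge:
  assumes "prefix (c @ [i]) a" "prefix (c @ [j]) b" "i \<noteq> j"
  shows "lcp a b = c"
proof (rule lcp_eqI)
  fix d assume d: "prefix d a" "prefix d b"
  have "prefix d c \<or> (prefix (c @ [i]) d \<and> prefix (c @ [j]) d)"
    using assms(1,2) d
    by (metis prefix_same_cases prefix_snoc append_prefixD)
  with \<open>i \<noteq> j\<close> show "prefix d c"
    by (auto simp: prefix_def)
qed (use assms in \<open>auto dest: append_prefixD\<close>)

lemma incomparable_diverge:
  assumes "\<not> prefix a b" "\<not> prefix b a"
  obtains i j where "i \<noteq> j" "prefix (lcp a b @ [i]) a" "prefix (lcp a b @ [j]) b"
proof -
  obtain c i as j bs where "i \<noteq> j" "a = c @ i # as" "b = c @ j # bs"
    using parallel_decomp[of a b] assms by blast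
  moreover from this have "lcp a b = c"
    by (intro lcp_diverge[of c i a j b]) auto
  ultimately show thesis by (intro that[of i j]) auto
qed

lemma prefix_ext:
  assumes "\<And>d. prefix d a \<longleftrightarrow> prefix d b"
  shows "a = b"
  using assms[of a] assms[of b] by (simp add: prefix_order.eq_iff)

lemma lcp_assoc: "lcp (lcp a b) c = lcp a (lcp b c)"
  by (rule prefix_ext) (simp add: prefix_lcp_iff)

lemma lcp_commute: "lcp a b = lcp b a"
  by (rule prefix_ext) (auto simp add: prefix_lcp_iff)

text \<open>The ultrametric property: \<open>lcp a c\<close> and \<open>lcp b c\<close> are prefixes
  of the same list \<open>c\<close>, hence comparable, and the shorter one is the triple
  meet.\<close>

lemma lcp_lcp_cases: "lcp (lcp a b) c = lcp a c \<or> lcp (lcp a b) c = lcp b c"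
proof -
  have *: "lcp (lcp a b) c = lcp a c" if "prefix (lcp a c) (lcp b c)" for a b
  proof (rule prefix_ext)
    fix d
    have "prefix d (lcp a c) \<Longrightarrow> prefix d (lcp b c)"
      using that prefix_order.trans by blast
    then show "prefix d (lcp (lcp a b) c) \<longleftrightarrow> prefix d (lcp a c)"
      by (auto simp: prefix_lcp_iff)
  qed
  have "prefix (lcp a c) (lcp b c) \<or> prefix (lcp b c) (lcp a c)"
    by (meson longest_common_prefix_prefix2 prefix_same_cases)
  then show ?thesis
    using *[of a b] *[of b a] by (auto simp: lcp_commute)
qed

section \<open>Trees of covering pairs\<close>

text \<open>
  \<open>a\<close> branches off to the left of \<open>b\<close>; the comparable pairs of the lexicographic order are excluded.
\<close>

definition leftp :: "'a::linorder list \<Rightarrow> 'a list \<Rightarrow> bool" where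
  "leftp a b \<longleftrightarrow> (\<exists>c i j. prefix (c @ [i]) a \<and> prefix (c @ [j]) b \<and> i < j)"

definition covers :: "'a list set \<Rightarrow> 'a list \<Rightarrow> 'a list \<Rightarrow> bool" where
  "covers X a b \<longleftrightarrow> a \<in> X \<and> b \<in> X \<and> strict_prefix a b \<and>
     (\<forall>c\<in>X. prefix a c \<longrightarrow> prefix c b \<longrightarrow> c = a \<or> c = b)"

text \<open>The Hasse diagram of \<open>X\<close> under \<open>prefix\<close>. It gives
  \<open>tree_of T\<close> and the reductions a common form; the \<open>THE\<close> is meaningful
  when \<open>X\<close> has a least element.\<close>

definition cover_tree :: "'a::linorder list set \<Rightarrow> 'a list planar_tree" where
  "cover_tree X =
     \<lparr>vertices = X,
      edges = {{a, b} | a b. covers X a b},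
      root_of = (THE r. r \<in> X \<and> (\<forall>a\<in>X. prefix r a)),
      left_of = {(a, b). leftp a b \<and> (\<exists>c. covers X c a \<and> covers X c b)}\<rparr>"

lemma cover_tree_sel [simp]:
  "vertices (cover_tree X) = X"
  "edges (cover_tree X) = {{a, b} | a b. covers X a b}"
  "left_of (cover_tree X) = {(a, b). leftp a b \<and> (\<exists>c. covers X c a \<and> covers X c b)}"
  by (simp_all add: cover_tree_def)

lemma root_of_cover_tree:
  assumes "r \<in> X" "\<And>a. a \<in> X \<Longrightarrow> prefix r a"
  shows "root_of (cover_tree X) = r"
proof -
  have "(THE r. r \<in> X \<and> (\<forall>a\<in>X. prefix r a)) = r"
  proof (rule the_equality)
    fix r' assume "r' \<in> X \<and> (\<forall>a\<in>X. prefix r' a)"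
    then show "r' = r" using assms by (simp add: prefix_order.eq_iff)
  qed (use assms in simp)
  then show ?thesis by (simp add: cover_tree_def)
qed

lemma edge_cover_tree: "{a, b} \<in> edges (cover_tree X) \<longleftrightarrow> covers X a b \<or> covers X b a"
  unfolding cover_tree_sel doubleton_eq_iff mem_Collect_eq by blast

definition lcp_closed :: "'a list set \<Rightarrow> bool" where
  "lcp_closed X \<longleftrightarrow> (\<forall>a\<in>X. \<forall>b\<in>X. lcp a b \<in> X)"

definition prefix_closed :: "'a list set \<Rightarrow> bool" where
  "prefix_closed X \<longleftrightarrow> (\<forall>a\<in>X. \<forall>b. prefix b a \<longrightarrow> b \<in> X)"

lemma prefix_closedD: "prefix_closed X \<Longrightarrow> a \<in> X \<Longrightarrow> prefix b a \<Longrightarrow> b \<in> X"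
  by (auto simp: prefix_closed_def)

lemma prefix_closed_imp_lcp_closed: "prefix_closed X \<Longrightarrow> lcp_closed X"
  unfolding lcp_closed_def by (simp add: prefix_closedD[OF _ _ longest_common_prefix_prefix1])

text \<open>The one-letter extension of \<open>a\<close> towards \<open>b\<close> belongs to
  \<open>X\<close> and lies between them, so a covering pair differs by exactly one letter.\<close>

lemma covers_prefix_closed:
  assumes "prefix_closed X"
  shows "covers X a b \<longleftrightarrow> b \<in> X \<and> (\<exists>i. b = a @ [i])"
proof
  assume c: "covers X a b"
  then obtain i as where b: "b = a @ i # as"
    unfolding covers_def strict_prefix_def by (metis append_Nil2 neq_Nil_conv prefix_def)
  have "a @ [i] \<in> X"
    using c b assms by (auto simp: covers_def intro: prefix_closedD)
  then have "a @ [i] = b"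
    using c b by (auto simp: covers_def dest!: bspec[of _ _ "a @ [i]"])
  then show "b \<in> X \<and> (\<exists>i. b = a @ [i])" using c by (auto simp: covers_def)
next
  assume "b \<in> X \<and> (\<exists>i. b = a @ [i])"
  then obtain i where i: "b = a @ [i]" "b \<in> X" by blast
  moreover have "a \<in> X" using prefix_closedD[OF assms i(2), of a] i by simp
  moreover have "c = a \<or> c = b" if "prefix a c" "prefix c b" for c
    using that prefix_order.antisym[of c a] unfolding i prefix_snoc by blast
  ultimately show "covers X a b"
    by (auto simp: covers_def strict_prefix_def)
qed

lemma root_of_cover_tree_prefix_closed:
  assumes "prefix_closed X" "X \<noteq> {}"
  shows "root_of (cover_tree X) = []"
  using assms by (intro root_of_cover_tree) (auto simp: prefix_closed_def)

section \<open>Simple paths\<close>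

text \<open>A walk that starts in \<open>C\<close> and ends outside takes a step out of
  \<open>C\<close>, and \<open>c\<close> is the only exit.\<close>

lemma crossing:
  assumes "successively R ps" "ps \<noteq> []" "hd ps \<in> C" "last ps \<notin> C"
    and "\<And>x y. x \<in> C \<Longrightarrow> y \<notin> C \<Longrightarrow> R x y \<Longrightarrow> x = c"
  shows "c \<in> set ps"
  using assms(1-4)
proof (induction ps)
  case (Cons p ps)
  then show ?case
    using assms(5) by (cases ps) (auto split: if_splits)
qed simp

text \<open>An excursion out of \<open>C\<close> has to leave and to return through the single
  boundary vertex \<open>c\<close>, so \<open>c\<close> would occur twice.\<close>

lemma no_double_crossing:
  assumes "successively R ps" "distinct ps" "hd ps \<in> C" "last ps \<in> C"
    and "w \<in> set ps" "w \<notin> C" "c \<in> C" and sym: "\<And>x y. R x y \<Longrightarrow> R y x"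
    and bd: "\<And>x y. x \<in> C \<Longrightarrow> y \<notin> C \<Longrightarrow> R x y \<Longrightarrow> x = c"
  shows False
proof -
  obtain xs ys where ps: "ps = xs @ w # ys"
    using \<open>w \<in> set ps\<close> by (auto simp: in_set_conv_decomp)
  have "xs \<noteq> []" "ys \<noteq> []" using assms ps by auto
  \<comment> \<open>The walk is cut at \<open>w\<close>; the second half, reversed, also starts in
    \<open>C\<close> and ends at \<open>w\<close>, so \<open>crossing\<close> puts \<open>c\<close>
    in both halves.\<close>
  have "successively R (xs @ [w])" "successively R (w # ys)"
    using assms(1) unfolding ps by (auto simp: successively_append_iff successively_Cons)
  moreover from this(2) have "successively R (rev (w # ys))"
    unfolding successively_rev using sym by (auto intro: successively_mono)
  ultimately have "c \<in> set (xs @ [w])" "c \<in> set (rev (w # ys))"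
    using assms(3,4,6) \<open>xs \<noteq> []\<close> \<open>ys \<noteq> []\<close> bd
    by (intro crossing[where C = C and R = R]; auto simp: ps last_rev hd_append hd_rev)+
  with assms(2,6,7) show False by (auto simp: ps)
qed

text \<open>Loop erasure: if the new starting vertex already lies on the simple path, the part
  before it is dropped.\<close>

lemma simple_path_exists:
  assumes "(\<lambda>u v. {u, v} \<in> edges T \<and> u \<in> vertices T)\<^sup>*\<^sup>* a b" "b \<in> vertices T"
  shows "\<exists>ps. simple_path T a b ps"
  using assms
proof (induction rule: converse_rtranclp_induct)
  case base
  then show ?case by (auto simp: simple_path_def intro!: exI[of _ "[b]"])
next
  case (step a a')
  then obtain ps where ps: "simple_path T a' b ps" by auto
  show ?case
  proof (cases "a \<in> set ps")
    case True
    then obtain xs ys where "ps = xs @ a # ys" by (auto simp: in_set_conv_decomp)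
    with ps have "simple_path T a b (a # ys)"
      by (auto simp: simple_path_def successively_append_iff)
    then show ?thesis ..
  next
    case False
    then have "simple_path T a b (a # ps)"
      using ps step by (auto simp: simple_path_def successively_Cons)
    then show ?thesis ..
  qed
qed

lemma simple_path_exists_cover_tree:
  assumes "prefix_closed W" "a \<in> W" "b \<in> W"
  shows "\<exists>ps. simple_path (cover_tree W) a b ps"
proof (rule simple_path_exists)
  let ?R = "\<lambda>u v. {u, v} \<in> edges (cover_tree W) \<and> u \<in> vertices (cover_tree W)"
  have "?R\<^sup>*\<^sup>* c [] \<and> ?R\<^sup>*\<^sup>* [] c" if "c \<in> W" for c
    using that
  proof (induction c rule: rev_induct)
    case (snoc i c)
    have "c \<in> W" using snoc.prems assms(1) by (auto intro: prefix_closedD)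
    then have s: "?R c (c @ [i])" "?R (c @ [i]) c"
      unfolding edge_cover_tree covers_prefix_closed[OF assms(1)] using snoc.prems by auto
    from snoc.IH[OF \<open>c \<in> W\<close>] have "?R\<^sup>*\<^sup>* c []" "?R\<^sup>*\<^sup>* [] c" by auto
    then show ?case
      using converse_rtranclp_into_rtranclp[of ?R, OF s(2)] rtranclp.rtrancl_into_rtrancl[of ?R, OF _ s(1)]
      by blast
  qed simp
  then show "?R\<^sup>*\<^sup>* a b" using assms by (meson rtranclp_trans)
qed (use assms in auto)

text \<open>
  The only edge between \<open>{w. prefix v w}\<close> and its complement joins \<open>v\<close> to its parent, so a simple path
  crosses it at most once, and exactly once iff precisely one of its ends is in that set.
\<close>

lemma path_cover_tree:
  assumes W: "prefix_closed W" and "a \<in> W" "b \<in> W"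
  shows "path (cover_tree W) a b = {v. (prefix v a \<or> prefix v b) \<and> prefix (lcp a b) v}"
proof -
  define R where "R = (\<lambda>u v. {u, v} \<in> edges (cover_tree W))"
  have R: "R u v \<longleftrightarrow> (v \<in> W \<and> (\<exists>i. v = u @ [i])) \<or> (u \<in> W \<and> (\<exists>i. u = v @ [i]))" for u v
    unfolding R_def edge_cover_tree covers_prefix_closed[OF W] by auto
  have sym: "R u v \<Longrightarrow> R v u" for u v by (auto simp: R)
  have sp: "simple_path (cover_tree W) x y ps \<longleftrightarrow>
      ps \<noteq> [] \<and> hd ps = x \<and> last ps = y \<and> distinct ps \<and> set ps \<subseteq> W \<and> successively R ps" for x y ps
    by (simp add: simple_path_def R_def)
  have out: "x = c" if "prefix c x" "\<not> prefix c y" "R x y" for x y c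
    using that by (auto simp: R)
  have inn: "x = c" if "\<not> prefix (c @ [i]) x" "prefix (c @ [i]) y" "R x y" for x y c i
    using that by (auto simp: R)
  have only: "(prefix v a \<or> prefix v b) \<and> prefix (lcp a b) v"
    if ps: "simple_path (cover_tree W) a b ps" and v: "v \<in> set ps" for ps v
  proof (intro conjI, goal_cases)
    case 1
    show ?case
    proof (rule ccontr)
      assume n: "\<not> ?thesis"
      then have "v \<noteq> []" by auto
      then obtain u i where u: "v = u @ [i]" by (cases v rule: rev_cases) auto
      \<comment> \<open>Here \<open>C\<close> is the complement of the cone below \<open>v\<close>;
        its only boundary vertex is the parent \<open>u\<close> of \<open>v\<close>.\<close>
      show False
        using ps v n unfolding sp u
        by (intro no_double_crossing[of R ps "{w. \<not> prefix (u @ [i]) w}" v u])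
          (auto simp: u sym dest: inn)
    qed
  next
    case 2
    show ?case
    proof (rule ccontr)
      assume n: "\<not> ?thesis"
      show False
        using ps v n unfolding sp
        by (intro no_double_crossing[of R ps "{w. prefix (lcp a b) w}" v "lcp a b"])
          (auto simp: sym longest_common_prefix_prefix1 longest_common_prefix_prefix2 dest: out)
    qed
  qed
  have on: "v \<in> set ps"
    if ps: "simple_path (cover_tree W) x y ps" and v: "prefix v x" "prefix (lcp x y) v" for ps v x y
  proof (cases "prefix v y")
    case True
    then have "prefix v (lcp x y)" using v by (simp add: prefix_lcp_iff)
    with v have l: "lcp x y = v" by (simp add: prefix_order.antisym)
    show ?thesis
    proof (cases "v = y")
      case True
      then show ?thesis using ps by (auto simp: sp)
    next
      case False
      with \<open>prefix v y\<close> obtain i where i: "prefix (v @ [i]) y"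
        by (metis append_Cons append_Nil2 neq_Nil_conv prefix_def append_assoc append_Nil)
      \<comment> \<open>Now \<open>v\<close> is the meet, so the cone below \<open>v @ [i]\<close>
        contains \<open>y\<close> but not \<open>x\<close>, and the path can enter it only from
        \<open>v\<close>.\<close>
      then have "\<not> prefix (v @ [i]) x"
        using l by (metis prefix_lcp_iff append_Nil2 not_Cons_self2 prefix_order.antisym prefixI same_append_eq)
      then show ?thesis
        using ps i unfolding sp
        by (intro crossing[of R ps "{w. \<not> prefix (v @ [i]) w}" v]) (auto dest: inn)
    qed
  next
    case False
    then show ?thesis
      using ps v unfolding sp
      by (intro crossing[of R ps "{w. prefix v w}" v]) (auto dest: out)
  qed
  have on': "v \<in> set ps"
    if ps: "simple_path (cover_tree W) a b ps" and v: "prefix v b" "prefix (lcp a b) v" for ps v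
  proof -
    have "simple_path (cover_tree W) b a (rev ps)"
      using ps sym by (auto simp: sp hd_rev last_rev intro: successively_mono)
    moreover have "prefix (lcp b a) v"
      using v(2) by (simp add: lcp_commute)
    ultimately show ?thesis using on[of b a "rev ps" v] v by simp
  qed
  obtain ps where "simple_path (cover_tree W) a b ps"
    using simple_path_exists_cover_tree[OF assms] by blast
  then show ?thesis
    unfolding path_def using only on on' by blast
qed

section \<open>Contraction\<close>

lemma edge_cover_tree_prefix_closed:
  assumes "prefix_closed W"
  shows "{a, b} \<in> edges (cover_tree W) \<longleftrightarrow>
    (b \<in> W \<and> (\<exists>i. b = a @ [i])) \<or> (a \<in> W \<and> (\<exists>i. a = b @ [i]))"
  unfolding edge_cover_tree covers_prefix_closed[OF assms] ..

lemma path_root_cover_tree: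
  assumes "prefix_closed W" "a \<in> W"
  shows "path (cover_tree W) a (root_of (cover_tree W)) = {v. prefix v a}"
proof -
  have "[] \<in> W" using assms by (simp add: prefix_closedD[of W a])
  moreover from this have "root_of (cover_tree W) = []"
    using root_of_cover_tree_prefix_closed assms by blast
  ultimately show ?thesis
    using assms by (auto simp: path_cover_tree lcp_absorb2)
qed

lemma children_cover_tree:
  assumes "prefix_closed W"
  shows "children (cover_tree W) p = {p @ [i] | i. p @ [i] \<in> W}"
proof (intro set_eqI iffI)
  fix w assume "w \<in> children (cover_tree W) p"
  then show "w \<in> {p @ [i] | i. p @ [i] \<in> W}"
    unfolding children_def edge_cover_tree_prefix_closed[OF assms]
    by (auto simp: path_root_cover_tree[OF assms])
next
  fix w assume "w \<in> {p @ [i] | i. p @ [i] \<in> W}"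
  then show "w \<in> children (cover_tree W) p"
    unfolding children_def edge_cover_tree_prefix_closed[OF assms]
    by (auto simp: path_root_cover_tree[OF assms])
qed

lemma arity_cover_tree:
  assumes "prefix_closed W"
  shows "arity (cover_tree W) p = card {i. p @ [i] \<in> W}"
proof -
  have "children (cover_tree W) p = (\<lambda>i. p @ [i]) ` {i. p @ [i] \<in> W}"
    unfolding children_cover_tree[OF assms] by auto
  then show ?thesis
    unfolding arity_def by (simp add: card_image inj_on_def)
qed

lemma leftp_snoc [simp]: "leftp (c @ [i]) (c @ [j]) \<longleftrightarrow> i < j"
\<comment> \<open>Both \<open>d\<close> and \<open>c\<close> are the longest common prefix of the
  two lists, so they coincide.\<close>
proof
  assume "leftp (c @ [i]) (c @ [j])"
  then obtain d k l where d: "prefix (d @ [k]) (c @ [i])" "prefix (d @ [l]) (c @ [j])" "k < l"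
    unfolding leftp_def by blast
  then have "lcp (c @ [i]) (c @ [j]) = d" "i \<noteq> j"
    by (auto intro: lcp_diverge simp: prefix_def)
  moreover from this have "lcp (c @ [i]) (c @ [j]) = c"
    by (intro lcp_diverge[of c i _ j]) auto
  ultimately show "i < j" using d by auto
next
  show "i < j \<Longrightarrow> leftp (c @ [i]) (c @ [j])"
    unfolding leftp_def by blast
qed

section \<open>The spanned subtree and its reduction\<close>

definition downset :: "'a list set \<Rightarrow> 'a list set" where
  "downset I = {p. \<exists>a\<in>I. prefix p a}"

lemma prefix_closed_downset: "prefix_closed (downset I)"
  unfolding prefix_closed_def downset_def using prefix_order.trans by blast

lemma downset_subset: "prefix_closed W \<Longrightarrow> I \<subseteq> W \<Longrightarrow> downset I \<subseteq> W"
  unfolding prefix_closed_def downset_def by blast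

text \<open>Paths to the root are sets of prefixes, so their union is \<open>downset I\<close>.
  Covering means one-letter extension in both prefix-closed sets, so edges and sibling order simply
  restrict.\<close>

lemma span_tree_cover_tree:
  assumes W: "prefix_closed W" and "I \<subseteq> W" "I \<noteq> {}"
  shows "span_tree (cover_tree W) I = cover_tree (downset I)"
proof -
  have D: "prefix_closed (downset I)" "downset I \<subseteq> W" "downset I \<noteq> {}"
    using prefix_closed_downset downset_subset[OF W] assms by (auto simp: downset_def)
  have un: "(\<Union>a\<in>I. path (cover_tree W) a (root_of (cover_tree W))) = downset I"
  proof -
    have "path (cover_tree W) a (root_of (cover_tree W)) = {v. prefix v a}" if "a \<in> I" for a
      using that assms by (intro path_root_cover_tree) auto
    then show ?thesis by (auto simp: downset_def)
  qed
  have cov: "covers (downset I) a b \<longleftrightarrow> covers W a b \<and> b \<in> downset I" for a b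
    using D by (auto simp: covers_prefix_closed W)
  have sub: "covers W a b \<Longrightarrow> b \<in> downset I \<Longrightarrow> a \<in> downset I" for a b
    using prefix_closedD[OF D(1)] by (auto simp: covers_prefix_closed[OF W])
  have "{e \<in> edges (cover_tree W). e \<subseteq> downset I} = edges (cover_tree (downset I))"
    unfolding cover_tree_sel cov using sub by blast
  moreover have "left_of (cover_tree W) \<inter> downset I \<times> downset I = left_of (cover_tree (downset I))"
    unfolding cover_tree_sel cov by blast
  moreover have "root_of (cover_tree W) = root_of (cover_tree (downset I))"
    using D assms root_of_cover_tree_prefix_closed by (metis subset_empty)
  ultimately show ?thesis
    unfolding span_tree_def Let_def un by (intro planar_tree.equality) auto
qed

text \<open>The case \<open>a = b\<close> is allowed, so the elements of \<open>I\<close> are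
  included along with the branching points between them.\<close>

definition meets :: "'a list set \<Rightarrow> 'a list set" where
  "meets I = {lcp a b | a b. a \<in> I \<and> b \<in> I}"

text \<open>The meet of four elements collapses to the meet of two of them by applying
  \<open>lcp_lcp_cases\<close> twice.\<close>

lemma lcp_closed_meets: "lcp_closed (meets I)"
  unfolding lcp_closed_def
proof (intro ballI)
  fix p q assume "p \<in> meets I" "q \<in> meets I"
  then obtain a b c d where abcd: "a \<in> I" "b \<in> I" "c \<in> I" "d \<in> I" "p = lcp a b" "q = lcp c d"
    by (auto simp: meets_def)
  then have "lcp p q = lcp (lcp (lcp a b) c) d"
    by (simp add: lcp_assoc)
  then have "lcp p q \<in> {lcp a d, lcp b d, lcp c d}"
    using lcp_lcp_cases[of a b c] lcp_lcp_cases[of a c d] lcp_lcp_cases[of b c d] by auto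
  with abcd show "lcp p q \<in> meets I"
    by (auto simp: meets_def)
qed

lemma subset_meets: "I \<subseteq> meets I"
proof
  fix a assume "a \<in> I"
  moreover have "lcp a a = a" by (simp add: lcp_absorb1)
  ultimately show "a \<in> meets I" unfolding meets_def by force
qed

lemma meets_subset: "lcp_closed X \<Longrightarrow> I \<subseteq> X \<Longrightarrow> meets I \<subseteq> X"
  by (auto simp: meets_def lcp_closed_def)

definition antichain :: "'a list set \<Rightarrow> bool" where
  "antichain I \<longleftrightarrow> (\<forall>a\<in>I. \<forall>b\<in>I. prefix a b \<longrightarrow> a = b)"

lemma strict_prefix_snoc:
  assumes "prefix a b" "a \<noteq> b"
  obtains i where "prefix (a @ [i]) b"
proof -
  obtain cs where "b = a @ cs" using assms by (auto simp: prefix_def)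
  moreover from this obtain i ds where "cs = i # ds"
    using assms by (cases cs) auto
  ultimately show thesis by (intro that[of i]) auto
qed

text \<open>A vertex with two children is where two elements of \<open>I\<close> diverge; one
  without children is itself in \<open>I\<close>. Conversely the antichain condition keeps elements
  of \<open>I\<close> childless and makes distinct elements diverge.\<close>

lemma red_vertices_downset:
  assumes "antichain I"
  shows "red_vertices (cover_tree (downset I)) = meets I"
proof (intro set_eqI iffI)
  fix p assume "p \<in> red_vertices (cover_tree (downset I))"
  then have p: "p \<in> downset I" "card {i. p @ [i] \<in> downset I} \<noteq> 1"
    by (auto simp: red_vertices_def arity_cover_tree prefix_closed_downset)
  show "p \<in> meets I"
  proof (cases "\<exists>i. p @ [i] \<in> downset I")
    case True
    then obtain i j where "i \<noteq> j" "p @ [i] \<in> downset I" "p @ [j] \<in> downset I"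
      using p(2) unfolding One_nat_def card_1_singleton_iff by blast
    then obtain a b where "a \<in> I" "b \<in> I" "prefix (p @ [i]) a" "prefix (p @ [j]) b"
      unfolding downset_def by blast
    with \<open>i \<noteq> j\<close> lcp_diverge[of p i a j b] show ?thesis
      unfolding meets_def by blast
  next
    case False
    obtain a where "a \<in> I" "prefix p a"
      using p by (auto simp: downset_def)
    with False have "p = a"
      using strict_prefix_snoc[of p a] unfolding downset_def by blast
    with \<open>a \<in> I\<close> subset_meets show ?thesis by blast
  qed
next
  fix p assume "p \<in> meets I"
  then obtain a b where ab: "a \<in> I" "b \<in> I" "p = lcp a b"
    by (auto simp: meets_def)
  have "card {i. p @ [i] \<in> downset I} \<noteq> 1"
  proof (cases "a = b")
    case True
    then have "p \<in> I" using ab by (simp add: lcp_absorb1)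
    then have "p @ [i] \<notin> downset I" for i
    proof -
      have "\<not> prefix (p @ [i]) c" if "c \<in> I" for c
      proof
        assume "prefix (p @ [i]) c"
        moreover from this have "prefix p c" by (rule append_prefixD)
        ultimately show False
          using assms \<open>p \<in> I\<close> that unfolding antichain_def by (metis prefix_snoc not_Cons_self2 same_prefix_nil)
      qed
      then show ?thesis by (auto simp: downset_def)
    qed
    then show ?thesis by simp
  next
    case False
    then have "\<not> prefix a b" "\<not> prefix b a"
      using assms ab unfolding antichain_def by metis+
    then obtain i j where "i \<noteq> j" "prefix (p @ [i]) a" "prefix (p @ [j]) b"
      using ab(3) by (metis incomparable_diverge)
    with ab have "i \<noteq> j" "p @ [i] \<in> downset I" "p @ [j] \<in> downset I"
      unfolding downset_def by blast+
    then show ?thesis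
      unfolding One_nat_def card_1_singleton_iff by (metis mem_Collect_eq singletonD)
  qed
  moreover have "p \<in> downset I"
    using ab longest_common_prefix_prefix1 unfolding downset_def by blast
  ultimately show "p \<in> red_vertices (cover_tree (downset I))"
    by (auto simp: red_vertices_def arity_cover_tree prefix_closed_downset)
qed

lemma meets_subset_downset: "meets I \<subseteq> downset I"
  unfolding meets_def downset_def using longest_common_prefix_prefix1 by blast

text \<open>Between comparable vertices the path is the interval of the prefix order, so the edge
  condition is exactly the covering condition.\<close>

lemma red_edge_iff:
  assumes "antichain I"
  shows "{a, b} \<in> red_edges (cover_tree (downset I)) \<longleftrightarrow>
    covers (meets I) a b \<or> covers (meets I) b a"
proof -
  let ?W = "downset I" and ?M = "meets I"
  have path: "path (cover_tree ?W) x y = {v. (prefix v x \<or> prefix v y) \<and> prefix (lcp x y) v}"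
    if "x \<in> ?M" "y \<in> ?M" for x y
    using that meets_subset_downset by (intro path_cover_tree prefix_closed_downset) auto
  have path_sym: "path (cover_tree ?W) x y = path (cover_tree ?W) y x"
    if "x \<in> ?M" "y \<in> ?M" for x y
    using that by (auto simp: path lcp_commute)
  have comparable: "path (cover_tree ?W) x y \<inter> ?M \<subseteq> {x, y} \<and> x \<noteq> y \<longleftrightarrow> covers ?M x y"
    if "x \<in> ?M" "y \<in> ?M" "prefix x y" for x y
  proof -
    have "path (cover_tree ?W) x y = {v. prefix x v \<and> prefix v y}"
      using that(3) prefix_order.trans unfolding path[OF that(1,2)] lcp_absorb1[OF that(3)] by blast
    then show ?thesis
      using that unfolding covers_def strict_prefix_def by blast
  qed
  have "path (cover_tree ?W) a b \<inter> ?M \<subseteq> {a, b} \<and> a \<noteq> b \<longleftrightarrow> covers ?M a b \<or> covers ?M b a"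
    if ab: "a \<in> ?M" "b \<in> ?M"
  proof -
    have asym: "\<not> covers ?M y x" if "prefix x y" for x y
      using that prefix_order.antisym[of x y] unfolding covers_def strict_prefix_def by blast
    consider "prefix a b" | "prefix b a" | "\<not> prefix a b" "\<not> prefix b a" by blast
    then show ?thesis
    proof cases
      case 1
      then show ?thesis using comparable[OF ab] asym by blast
    next
      case 2
      then show ?thesis
        using comparable[OF ab(2,1)] asym path_sym[OF ab] by (simp add: insert_commute eq_commute)
    next
      \<comment> \<open>Incomparable vertices are never joined: their meet is a third reduced vertex
        on the path.\<close>
      case 3
      have "lcp a b \<in> path (cover_tree ?W) a b \<inter> ?M"
        using ab lcp_closed_meets[of I, unfolded lcp_closed_def] unfolding path[OF ab]
        by (simp add: longest_common_prefix_prefix1)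
      moreover have "lcp a b \<noteq> a" "lcp a b \<noteq> b"
        using 3 longest_common_prefix_prefix1 longest_common_prefix_prefix2 by metis+
      ultimately show ?thesis
        using 3 by (auto simp: covers_def)
    qed
  qed
  moreover have "{a, b} \<in> red_edges (cover_tree ?W) \<longleftrightarrow>
      a \<in> ?M \<and> b \<in> ?M \<and> path (cover_tree ?W) a b \<inter> ?M \<subseteq> {a, b} \<and> a \<noteq> b"
  proof -
    \<comment> \<open>Symmetry of \<open>P\<close> is what allows membership of an unordered pair to
      be read as \<open>P a b\<close>.\<close>
    define P where "P x y \<longleftrightarrow> x \<in> ?M \<and> y \<in> ?M \<and> x \<noteq> y \<and> path (cover_tree ?W) x y \<inter> ?M \<subseteq> {x, y}" for x y
    have "P x y \<longleftrightarrow> P y x" for x y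
      using path_sym[of x y] by (auto simp: P_def)
    moreover have "red_edges (cover_tree ?W) = {{x, y} | x y. P x y}"
      unfolding red_edges_def red_vertices_downset[OF assms] P_def by blast
    ultimately have "{a, b} \<in> red_edges (cover_tree ?W) \<longleftrightarrow> P a b"
      by (auto simp: doubleton_eq_iff)
    then show ?thesis unfolding P_def by blast
  qed
  ultimately show ?thesis
    using covers_def[of ?M a b] covers_def[of ?M b a] by blast
qed

text \<open>The path from the root to \<open>v\<close> has \<open>length v + 1\<close> vertices, so
  \<open>arg_min\<close> selects a shortest meet; its meet with any other element cannot be shorter,
  so it is a prefix of all of them.\<close>

lemma arg_min_root_downset:
  assumes "I \<noteq> {}"
  shows "arg_min (\<lambda>v. card (path (cover_tree (downset I)) (root_of (cover_tree (downset I))) v)) (\<lambda>v. v \<in> meets I)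
    = root_of (cover_tree (meets I))" (is "arg_min ?f ?P = _")
proof -
  have W: "prefix_closed (downset I)" "downset I \<noteq> {}"
    using prefix_closed_downset assms by (auto simp: downset_def)
  have len: "?f v = Suc (length v)" if "v \<in> meets I" for v
  proof -
    have "v \<in> downset I" "[] \<in> downset I"
      using that meets_subset_downset prefix_closedD[OF W(1)] Nil_prefix by blast+
    then have "path (cover_tree (downset I)) [] v = set (prefixes v)"
      unfolding path_cover_tree[OF W(1) \<open>[] \<in> downset I\<close> \<open>v \<in> downset I\<close>]
      by (auto simp: lcp_absorb1)
    then show ?thesis
      unfolding root_of_cover_tree_prefix_closed[OF W] by simp
  qed
  obtain k where k: "k \<in> meets I" using assms subset_meets by blast
  define r where "r = arg_min ?f ?P"
  have r: "r \<in> meets I" "\<And>v. v \<in> meets I \<Longrightarrow> length r \<le> length v"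
    using arg_min_nat_lemma[of ?P k ?f] k len unfolding r_def by auto
  have "prefix r a" if "a \<in> meets I" for a
  proof -
    have "length r \<le> length (lcp r a)"
      using r(2) lcp_closed_meets r(1) that unfolding lcp_closed_def by blast
    then have "lcp r a = r"
      using longest_common_prefix_prefix1[of r a] by (elim prefixE) (metis append_Nil2 length_append
          le_add_same_cancel1 length_0_conv add_le_same_cancel1 le_zero_eq)
    then show ?thesis by (metis longest_common_prefix_prefix2)
  qed
  with r show ?thesis
    unfolding r_def[symmetric] by (metis root_of_cover_tree)
qed

lemma Red_cover_tree_downset:
  assumes "antichain I" "I \<noteq> {}"
  shows "Red (cover_tree (downset I)) = cover_tree (meets I)"
proof -
  let ?W = "downset I" and ?M = "meets I"
  note W = prefix_closed_downset[of I]
  have "left_of (Red (cover_tree ?W)) = left_of (cover_tree ?M)"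
  proof (intro set_eqI iffI; clarify)
    fix a b assume "(a, b) \<in> left_of (Red (cover_tree ?W))"
    then obtain c i j where
      e: "{c, a} \<in> red_edges (cover_tree ?W)" "{c, b} \<in> red_edges (cover_tree ?W)"
      and p: "c @ [i] \<in> path (cover_tree ?W) c a" "c @ [j] \<in> path (cover_tree ?W) c b"
      and "i < j"
      unfolding Red_def children_cover_tree[OF W] by auto
    from e have c: "covers ?M c a \<or> covers ?M a c" "covers ?M c b \<or> covers ?M b c"
      using red_edge_iff assms by blast+
    then have "c \<in> ?W" "a \<in> ?W" "b \<in> ?W"
      using meets_subset_downset unfolding covers_def by blast+
    \<comment> \<open>Reduced edges are unoriented. The starting child \<open>c @ [i]\<close> is too
      long to be a prefix of \<open>c\<close>, so it points down to \<open>a\<close>, and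
      \<open>c\<close> is the parent.\<close>
    with p have pre: "prefix (c @ [i]) a" "prefix (c @ [j]) b"
      by (auto simp: path_cover_tree[OF W])
    have "\<not> covers ?M a c" "\<not> covers ?M b c"
      using pre append_prefixD[OF pre(1)] append_prefixD[OF pre(2)]
        unfolding covers_def strict_prefix_def by (blast intro: prefix_order.antisym)+
    with c pre \<open>i < j\<close> show "(a, b) \<in> left_of (cover_tree ?M)"
      unfolding cover_tree_sel leftp_def by blast
  next
    fix a b assume "(a, b) \<in> left_of (cover_tree ?M)"
    then obtain c d i j where c: "covers ?M c a" "covers ?M c b"
      and d: "prefix (d @ [i]) a" "prefix (d @ [j]) b" "i < j"
      unfolding cover_tree_sel leftp_def by blast
    \<comment> \<open>The point \<open>d\<close> where \<open>a\<close> and \<open>b\<close> diverge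
      is a meet strictly above \<open>a\<close> and not above \<open>c\<close> in the tree, so
      covering forces \<open>d = c\<close>.\<close>
    have "lcp a b = d" using d lcp_diverge[of d i a j b] by simp
    then have "d \<in> ?M" "prefix c d" "prefix d a"
      using c lcp_closed_meets longest_common_prefix_prefix1
      unfolding covers_def lcp_closed_def strict_prefix_def
      by (auto simp flip: prefix_lcp_iff) (auto simp: prefix_lcp_iff)
    moreover have "d \<noteq> a" using d(1) by auto
    ultimately have "d = c" using c unfolding covers_def by blast
    have in_W: "a \<in> ?W" "b \<in> ?W" "c \<in> ?W"
      using c meets_subset_downset unfolding covers_def by blast+
    then have ij: "c @ [i] \<in> ?W" "c @ [j] \<in> ?W"
      using d prefix_closedD[OF W] unfolding \<open>d = c\<close> by blast+
    have "c @ [i] \<in> path (cover_tree ?W) c a" "c @ [j] \<in> path (cover_tree ?W) c b"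
      using d c unfolding \<open>d = c\<close> path_cover_tree[OF W \<open>c \<in> ?W\<close> \<open>a \<in> ?W\<close>]
        path_cover_tree[OF W \<open>c \<in> ?W\<close> \<open>b \<in> ?W\<close>]
      by (auto simp: covers_def strict_prefix_def lcp_absorb1)
    moreover have "(c @ [i], c @ [j]) \<in> left_of (cover_tree ?W)"
      using d ij by (auto simp: covers_prefix_closed[OF W])
    moreover have "{c, a} \<in> red_edges (cover_tree ?W)" "{c, b} \<in> red_edges (cover_tree ?W)"
      using c red_edge_iff assms by blast+
    ultimately show "(a, b) \<in> left_of (Red (cover_tree ?W))"
      using ij unfolding Red_def planar_tree.simps children_cover_tree[OF W] by blast
  qed
  moreover have "edges (Red (cover_tree ?W)) = edges (cover_tree ?M)"
  proof (intro set_eqI iffI)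
    fix e assume "e \<in> edges (Red (cover_tree ?W))"
    then obtain a b where "e = {a, b}" "{a, b} \<in> red_edges (cover_tree ?W)"
      unfolding Red_def planar_tree.simps by (auto simp: red_edges_def)
    then show "e \<in> edges (cover_tree ?M)"
      using red_edge_iff assms edge_cover_tree by blast
  next
    fix e assume "e \<in> edges (cover_tree ?M)"
    then obtain a b where "e = {a, b}" "covers ?M a b" by auto
    then show "e \<in> edges (Red (cover_tree ?W))"
      using red_edge_iff assms unfolding Red_def planar_tree.simps by blast
  qed
  moreover have "root_of (Red (cover_tree ?W)) = root_of (cover_tree ?M)"
    using arg_min_root_downset[OF assms(2)]
    unfolding Red_def planar_tree.simps red_vertices_downset[OF assms(1)] .
  moreover have "vertices (Red (cover_tree ?W)) = vertices (cover_tree ?M)"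
    by (simp add: Red_def red_vertices_downset assms)
  ultimately show ?thesis by (intro planar_tree.equality) auto
qed

section \<open>Isomorphisms\<close>

abbreviation verts :: "ptree \<Rightarrow> nat list set" where
  "verts T \<equiv> {p. is_vertex T p}"

lemma is_vertex_append: "is_vertex T (p @ q) \<Longrightarrow> is_vertex T p"
  by (induction T p rule: is_vertex.induct) auto

lemma prefix_closed_verts: "prefix_closed (verts T)"
  by (auto simp: prefix_closed_def prefix_def dest: is_vertex_append)

lemma is_vertex_snoc_less: "is_vertex T (p @ [i]) \<Longrightarrow> j < i \<Longrightarrow> is_vertex T (p @ [j])"
proof (induction T p rule: is_vertex.induct)
  case (1 T)
  then show ?case by (cases T) auto
qed auto

lemma tree_of_eq_cover_tree: "tree_of T = cover_tree (verts T)"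
proof -
  note cov = covers_prefix_closed[OF prefix_closed_verts[of T]]
  have "[] \<in> verts T" by simp
  then have "verts T \<noteq> {}" by blast
  then have "root_of (tree_of T) = root_of (cover_tree (verts T))"
    by (simp add: root_of_cover_tree_prefix_closed prefix_closed_verts tree_of_def)
  moreover have "edges (tree_of T) = edges (cover_tree (verts T))"
    unfolding tree_of_def planar_tree.simps cover_tree_sel cov by blast
  moreover have "left_of (tree_of T) = left_of (cover_tree (verts T))"
    unfolding tree_of_def planar_tree.simps cover_tree_sel cov by auto
  ultimately show ?thesis
    by (intro planar_tree.equality) (auto simp: tree_of_def)
qed

lemma mem_leaves_tree_of:
  "p \<in> leaves (tree_of T) \<longleftrightarrow> p \<in> verts T \<and> (\<forall>i. p @ [i] \<notin> verts T)"
proof -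
  \<comment> \<open>Finiteness is essential: \<open>card\<close> is 0 on infinite sets, so arity 0
    alone does not exclude children.\<close>
  have "finite {i. p @ [i] \<in> verts T}"
  proof (cases "\<exists>n. p @ [n] \<notin> verts T")
    case True
    then obtain n where "\<not> is_vertex T (p @ [n])" by auto
    then have "{i. p @ [i] \<in> verts T} \<subseteq> {..n}"
      using is_vertex_snoc_less[of T p] by (auto simp: not_le[symmetric])
    then show ?thesis using finite_subset by blast
  next
    case False
    have "\<exists>n. \<not> is_vertex T (p @ [n])"
    proof (induction T p rule: is_vertex.induct)
      case (1 T)
      then show ?case by (cases T) (auto intro: exI[of _ "length _"])
    qed auto
    with False show ?thesis by simp
  qed
  then show ?thesis
    unfolding leaves_def tree_of_eq_cover_tree arity_cover_tree[OF prefix_closed_verts] by auto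
qed

lemma antichain_leaves: "antichain (leaves (tree_of T))"
  unfolding antichain_def
proof (intro ballI impI, rule ccontr)
  fix a b assume "a \<in> leaves (tree_of T)" "b \<in> leaves (tree_of T)" "prefix a b" "a \<noteq> b"
  then show False
    using strict_prefix_snoc[of a b] prefix_closedD[OF prefix_closed_verts, of b T]
    unfolding mem_leaves_tree_of by blast
qed

lemma Red_span_tree_of:
  assumes "I \<subseteq> leaves (tree_of T)" "I \<noteq> {}"
  shows "Red (span_tree (tree_of T) I) = cover_tree (meets I)"
proof -
  have "I \<subseteq> verts T" using assms by (auto simp: mem_leaves_tree_of)
  moreover have "antichain I"
    using antichain_leaves[of T] assms(1) unfolding antichain_def by blast
  ultimately show ?thesis
    using assms(2) unfolding tree_of_eq_cover_tree
    by (simp add: span_tree_cover_tree prefix_closed_verts Red_cover_tree_downset)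
qed

text \<open>Unlike \<open>planar_iso\<close>, this compares all pairs of vertices and not only
  adjacent ones or siblings, so it survives restriction to subsets.\<close>

definition order_iso :: "('a::linorder list \<Rightarrow> 'b::linorder list) \<Rightarrow> 'a list set \<Rightarrow> 'b list set \<Rightarrow> bool" where
  "order_iso f X Y \<longleftrightarrow> bij_betw f X Y \<and> (\<forall>p\<in>X. \<forall>q\<in>X.
     (prefix (f p) (f q) \<longleftrightarrow> prefix p q) \<and> (leftp (f p) (f q) \<longleftrightarrow> leftp p q))"

text \<open>Covering, the root and the sibling relation are all definable from \<open>prefix\<close>
  and \<open>leftp\<close> within the vertex set.\<close>

lemma order_iso_planar_iso:
  assumes f: "order_iso f X Y" and r: "r \<in> X" "\<And>a. a \<in> X \<Longrightarrow> prefix r a"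
  shows "planar_iso (cover_tree X) (cover_tree Y)"
proof -
  have Y: "Y = f ` X" and inj: "inj_on f X"
    using f by (auto simp: order_iso_def bij_betw_def)
  have pre: "prefix (f p) (f q) \<longleftrightarrow> prefix p q" and left: "leftp (f p) (f q) \<longleftrightarrow> leftp p q"
    if "p \<in> X" "q \<in> X" for p q
    using f that by (auto simp: order_iso_def)
  have eq: "f p = f q \<longleftrightarrow> p = q" if "p \<in> X" "q \<in> X" for p q
    using inj that by (auto simp: inj_on_def)
  have cov: "covers Y (f p) (f q) \<longleftrightarrow> covers X p q" if "p \<in> X" "q \<in> X" for p q
    using that unfolding covers_def strict_prefix_def Y by (simp add: pre eq)
  have "f (root_of (cover_tree X)) = root_of (cover_tree Y)"
  proof -
    have "root_of (cover_tree Y) = f r"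
      using r by (intro root_of_cover_tree) (auto simp: Y pre)
    then show ?thesis using root_of_cover_tree[OF r] by simp
  qed
  moreover have "(\<exists>c. covers Y c (f u) \<and> covers Y c (f v)) \<longleftrightarrow> (\<exists>c. covers X c u \<and> covers X c v)"
    if "u \<in> X" "v \<in> X" for u v
  proof -
    have "(\<exists>c. covers Y c (f u) \<and> covers Y c (f v)) \<longleftrightarrow> (\<exists>c\<in>X. covers Y (f c) (f u) \<and> covers Y (f c) (f v))"
      unfolding Y by (auto simp: covers_def)
    also have "\<dots> \<longleftrightarrow> (\<exists>c. covers X c u \<and> covers X c v)"
      using that cov by (auto simp: covers_def[of X])
    finally show ?thesis .
  qed
  ultimately show ?thesis
    unfolding planar_iso_def edge_cover_tree using f cov left
    by (intro exI[of _ f]) (simp add: order_iso_def)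
qed

text \<open>One isomorphism is followed by the inverse of the other. This compares two candidates
  for the same contraction; \<open>root_of T\<close> must be a vertex for the inverse to return
  it.\<close>

lemma planar_iso_common_target:
  assumes "planar_iso S R" "planar_iso T R" and "root_of T \<in> vertices T"
  shows "planar_iso S T"
proof -
  obtain f where f: "bij_betw f (vertices S) (vertices R)" "f (root_of S) = root_of R"
    "\<And>u v. u \<in> vertices S \<Longrightarrow> v \<in> vertices S \<Longrightarrow>
       ({u, v} \<in> edges S \<longleftrightarrow> {f u, f v} \<in> edges R) \<and> ((u, v) \<in> left_of S \<longleftrightarrow> (f u, f v) \<in> left_of R)"
    using assms(1) unfolding planar_iso_def by blast
  obtain g where g: "bij_betw g (vertices T) (vertices R)" "g (root_of T) = root_of R"
    "\<And>u v. u \<in> vertices T \<Longrightarrow> v \<in> vertices T \<Longrightarrow>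
       ({u, v} \<in> edges T \<longleftrightarrow> {g u, g v} \<in> edges R) \<and> ((u, v) \<in> left_of T \<longleftrightarrow> (g u, g v) \<in> left_of R)"
    using assms(2) unfolding planar_iso_def by blast
  define h where "h = inv_into (vertices T) g"
  have h: "h y \<in> vertices T" "g (h y) = y" if "y \<in> vertices R" for y
    using g(1) that unfolding h_def bij_betw_def by (auto simp: inv_into_into f_inv_into_f)
  have fR: "f u \<in> vertices R" if "u \<in> vertices S" for u
    using f(1) that by (auto simp: bij_betw_def)
  have "bij_betw (h \<circ> f) (vertices S) (vertices T)"
    using f(1) g(1) bij_betw_inv_into bij_betw_trans unfolding h_def by blast
  moreover have "h (root_of R) = root_of T"
    using g(1,2) assms(3) unfolding h_def bij_betw_def by (metis inv_into_f_f)
  ultimately show ?thesis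
    unfolding planar_iso_def using f g(3) h fR
    by (intro exI[of _ "h \<circ> f"]) simp
qed

section \<open>Rigidity of the standard trees\<close>

lemma verts_inject:
  assumes "verts S = verts T"
  shows "S = T"
  using assms
proof (induction S arbitrary: T)
  case (Node Ss)
  obtain Ts where T: "T = Node Ts" by (cases T)
  have mem: "is_vertex (Node Ss) p \<longleftrightarrow> is_vertex T p" for p
    using Node.prems by blast
  have "i < length Ss \<longleftrightarrow> i < length Ts" for i
    using mem[of "[i]"] by (simp add: T)
  then have len: "length Ss = length Ts"
    by (metis linorder_neqE_nat less_irrefl)
  have "Ss ! i = Ts ! i" if "i < length Ss" for i
    using that mem[of "i # _"] len by (intro Node.IH) (auto simp: T)
  with len show ?case by (simp add: T nth_equalityI)
qed

text \<open>An isomorphism fixes every vertex, by induction on depth: the children of a fixed vertex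
  are permuted in order, and a child is determined by the number of siblings to its left.\<close>

lemma planar_iso_tree_of_imp_eq:
  assumes "planar_iso (tree_of S) (tree_of T)"
  shows "S = T"
proof -
  obtain f where bij: "bij_betw f (verts S) (verts T)" and root: "f [] = []"
    and edge: "\<And>u v. u \<in> verts S \<Longrightarrow> v \<in> verts S \<Longrightarrow>
       {u, v} \<in> edges (tree_of S) \<longleftrightarrow> {f u, f v} \<in> edges (tree_of T)"
    and left: "\<And>u v. u \<in> verts S \<Longrightarrow> v \<in> verts S \<Longrightarrow>
       (u, v) \<in> left_of (tree_of S) \<longleftrightarrow> (f u, f v) \<in> left_of (tree_of T)"
    using assms unfolding planar_iso_def by (auto simp: tree_of_def)
  have edge_iff: "{u, v} \<in> edges (tree_of R) \<longleftrightarrow>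
      (v \<in> verts R \<and> (\<exists>i. v = u @ [i])) \<or> (u \<in> verts R \<and> (\<exists>i. u = v @ [i]))" for R u v
    unfolding tree_of_eq_cover_tree by (rule edge_cover_tree_prefix_closed[OF prefix_closed_verts])
  have left_iff: "(p @ [i], p @ [j]) \<in> left_of (tree_of R) \<longleftrightarrow>
      p @ [i] \<in> verts R \<and> p @ [j] \<in> verts R \<and> i < j" for R p i j
    by (auto simp: tree_of_def)
  have inj: "u = v" if "f u = f v" "u \<in> verts S" "v \<in> verts S" for u v
    using bij_betw_imp_inj_on[OF bij] that by (rule inj_onD)
  have fix_f: "f p = p" if "p \<in> verts S" for p
    using that
  proof (induction p rule: measure_induct_rule[of length])
    case (less q)
    show ?case
    proof (cases q rule: rev_cases)
      case Nil
      then show ?thesis by (simp add: root)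
    next
      case (snoc p i)
      have "p \<in> verts S"
        using less.prems snoc is_vertex_append by simp
      moreover from this have "f p = p"
        using less.IH snoc by simp
      ultimately have p: "p \<in> verts S" "f p = p" .
      then have "p \<in> verts T" using bij by (metis bij_betwE)
      note p = p this
      \<comment> \<open>The image is adjacent to \<open>p\<close>. It is not the parent of
        \<open>p\<close>, since the parent is already fixed and \<open>f\<close> is
        injective.\<close>
      have child: "\<exists>j. f (p @ [k]) = p @ [j] \<and> p @ [j] \<in> verts T" if k: "p @ [k] \<in> verts S" for k
      proof -
        have "{p, f (p @ [k])} \<in> edges (tree_of T)"
          using edge[OF p(1) k] p k by (simp add: edge_iff)
        moreover have "\<not> (\<exists>j. p = f (p @ [k]) @ [j])"
        proof
          assume "\<exists>j. p = f (p @ [k]) @ [j]"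
          then obtain r j where r: "p = r @ [j]" "f (p @ [k]) = r" by blast
          then have "r \<in> verts S" using p(1) by (auto dest: is_vertex_append)
          then have "f r = r" using less.IH r snoc by simp
          then show False using inj[of r "p @ [k]"] r \<open>r \<in> verts S\<close> k by simp
        qed
        ultimately show ?thesis by (auto simp: edge_iff)
      qed
      \<comment> \<open>The same argument backwards: the preimage of a child of \<open>p\<close> is
        adjacent to \<open>p\<close> and is not its fixed parent.\<close>
      have parent: "\<exists>k. p @ [k] \<in> verts S \<and> f (p @ [k]) = p @ [j]" if j: "p @ [j] \<in> verts T" for j
      proof -
        obtain v where v: "v \<in> verts S" "f v = p @ [j]"
          using bij j unfolding bij_betw_def by (metis imageE)
        have "{p, v} \<in> edges (tree_of S)"
          using edge[OF p(1) v(1)] v p j by (simp add: edge_iff)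
        moreover have "\<not> (\<exists>i. p = v @ [i])"
        proof
          assume "\<exists>i. p = v @ [i]"
          then obtain i where "p = v @ [i]" by blast
          moreover from this have "f v = v" using less.IH v snoc by simp
          ultimately show False using v by simp
        qed
        ultimately show ?thesis using v by (auto simp: edge_iff)
      qed
      define g where "g k = last (f (p @ [k]))" for k
      have g: "f (p @ [k]) = p @ [g k]" "p @ [g k] \<in> verts T" if "p @ [k] \<in> verts S" for k
        using child[OF that] by (auto simp: g_def)
      have mono: "g k < g l \<longleftrightarrow> k < l" if "p @ [k] \<in> verts S" "p @ [l] \<in> verts S" for k l
        using left[OF that] g that by (simp add: left_iff)
      have i: "p @ [i] \<in> verts S" using less.prems snoc by simp
      have below: "p @ [k] \<in> verts S" if "k < i" for k
        using is_vertex_snoc_less[of S p i k] i that by simp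
      \<comment> \<open>The left siblings of child \<open>i\<close> correspond to those of child
        \<open>g i\<close>; positions have no gaps, so counting them gives
        \<open>i = g i\<close>.\<close>
      have "bij_betw g {..<i} {..<g i}"
        unfolding bij_betw_def
      proof
        show "inj_on g {..<i}"
          using below mono by (intro inj_onI) (metis lessThan_iff linorder_neqE_nat less_irrefl)
        show "g ` {..<i} = {..<g i}"
        proof (intro set_eqI iffI)
          fix j assume "j \<in> g ` {..<i}"
          then show "j \<in> {..<g i}" using mono[OF below i] by auto
        next
          fix j assume "j \<in> {..<g i}"
          then have "p @ [j] \<in> verts T"
            using is_vertex_snoc_less[of T p "g i" j] g(2)[OF i] by simp
          then obtain k where k: "p @ [k] \<in> verts S" "f (p @ [k]) = p @ [j]"
            using parent by blast
          then have "g k = j" using g by simp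
          moreover from this have "k < i" using mono[OF k(1) i] \<open>j \<in> _\<close> by simp
          ultimately show "j \<in> g ` {..<i}" by auto
        qed
      qed
      then have "i = g i" using bij_betw_same_card by fastforce
      then show ?thesis using g(1)[OF i] snoc by simp
    qed
  qed
  then have "f ` verts S = verts S" by force
  then have "verts S = verts T" using bij unfolding bij_betw_def by simp
  then show ?thesis by (rule verts_inject)
qed

section \<open>The left-of relation on arbitrary pairs of lists\<close>

lemma leftp_decomp:
  assumes "leftp p q"
  obtains i j where "prefix (lcp p q @ [i]) p" "prefix (lcp p q @ [j]) q" "i < j"
proof -
  obtain c i j where c: "prefix (c @ [i]) p" "prefix (c @ [j]) q" "i < j"
    using assms unfolding leftp_def by blast
  then have "lcp p q = c" using lcp_diverge[of c i p j q] by simp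
  with c show thesis by (intro that) auto
qed

lemma leftp_imp_not_prefix:
  assumes "leftp p q"
  shows "\<not> prefix p q" "\<not> prefix q p"
proof -
  obtain i j where "prefix (lcp p q @ [i]) p" "prefix (lcp p q @ [j]) q"
    using assms by (rule leftp_decomp)
  then show "\<not> prefix p q" "\<not> prefix q p"
    by (auto simp: lcp_absorb1 lcp_absorb2)
qed

lemma leftp_asym:
  assumes "leftp p q"
  shows "\<not> leftp q p"
proof
  assume "leftp q p"
  then obtain k l where kl: "prefix (lcp p q @ [k]) q" "prefix (lcp p q @ [l]) p" "k < l"
    using leftp_decomp[of q p] lcp_commute[of q p] by metis
  obtain i j where ij: "prefix (lcp p q @ [i]) p" "prefix (lcp p q @ [j]) q" "i < j"
    using assms by (rule leftp_decomp)
  \<comment> \<open>If \<open>i\<close> and \<open>l\<close> differed, \<open>p\<close> would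
    diverge from itself and thus be a prefix of \<open>q\<close>; likewise for \<open>j\<close>,
    \<open>k\<close> and \<open>q\<close>.\<close>
  have "lcp p p = lcp p q" if "i \<noteq> l"
    using lcp_diverge[OF ij(1) kl(2) that] .
  moreover have "lcp q q = lcp p q" if "j \<noteq> k"
    using lcp_diverge[OF ij(2) kl(1) that] .
  ultimately have "i = l" "j = k"
    using leftp_imp_not_prefix[OF assms] longest_common_prefix_prefix1[of p q]
      longest_common_prefix_prefix2[of p q]
    by (metis lcp_absorb1 prefix_order.refl)+
  with ij kl show False by simp
qed

lemma prefix_leftp_cases:
  obtains "p = q" | "strict_prefix p q" | "strict_prefix q p" | "leftp p q" | "leftp q p"
proof (cases "prefix p q \<or> prefix q p")
  case True
  then show thesis using that unfolding strict_prefix_def by blast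
next
  case False
  then obtain i j where ij: "i \<noteq> j" "prefix (lcp p q @ [i]) p" "prefix (lcp p q @ [j]) q"
    using incomparable_diverge by metis
  then have "leftp p q \<or> leftp q p"
    unfolding leftp_def by (cases "i < j") (blast dest: linorder_neqE)+
  then show thesis using that by blast
qed

text \<open>One-way preservation suffices: any two lists stand in exactly one of the relations of
  \<open>prefix_leftp_cases\<close>, so preserving each of them also reflects each, and injectivity
  follows.\<close>

lemma order_isoI:
  assumes Y: "f ` X = Y"
    and strict: "\<And>p q. p \<in> X \<Longrightarrow> q \<in> X \<Longrightarrow> strict_prefix p q \<Longrightarrow> strict_prefix (f p) (f q)"
    and left: "\<And>p q. p \<in> X \<Longrightarrow> q \<in> X \<Longrightarrow> leftp p q \<Longrightarrow> leftp (f p) (f q)"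
  shows "order_iso f X Y"
proof -
  have excl: "\<not> (strict_prefix u v \<and> strict_prefix v u)" "\<not> (strict_prefix u v \<and> leftp u v)"
    "\<not> (strict_prefix u v \<and> leftp v u)" "\<not> (leftp u v \<and> leftp v u)"
    for u v :: "'c::linorder list"
    using leftp_imp_not_prefix[of u v] leftp_imp_not_prefix[of v u] leftp_asym[of u v]
      prefix_order.antisym[of u v]
    unfolding strict_prefix_def by blast+
  have irrefl: "\<not> leftp u u" "\<not> strict_prefix u u" for u :: "'c::linorder list"
    using leftp_asym[of u u] unfolding strict_prefix_def by blast+
  have *: "(f p = f q \<longleftrightarrow> p = q) \<and> (strict_prefix (f p) (f q) \<longleftrightarrow> strict_prefix p q) \<and>
      (leftp (f p) (f q) \<longleftrightarrow> leftp p q)" if "p \<in> X" "q \<in> X" for p q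
    by (cases rule: prefix_leftp_cases[of p q])
      (use strict[of p q] strict[of q p] left[of p q] left[of q p] that
        excl[of p q] excl[of q p] excl[of "f p" "f q"] excl[of "f q" "f p"] irrefl in metis)+
  then have "prefix (f p) (f q) \<longleftrightarrow> prefix p q" if "p \<in> X" "q \<in> X" for p q
    using that unfolding strict_prefix_def by (metis prefix_order.refl)
  with * Y show ?thesis
    unfolding order_iso_def bij_betw_def inj_on_def by blast
qed

lemma order_iso_strict_prefix:
  assumes "order_iso f X Y" "p \<in> X" "q \<in> X"
  shows "strict_prefix (f p) (f q) \<longleftrightarrow> strict_prefix p q"
  using assms unfolding order_iso_def strict_prefix_def bij_betw_def inj_on_def by metis

lemma leftp_Nil [simp]: "\<not> leftp [] q" "\<not> leftp p []"
  by (auto simp: leftp_def)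

lemma leftp_Cons [simp]: "leftp (i # p) (j # q) \<longleftrightarrow> i < j \<or> i = j \<and> leftp p q"
proof
  assume "leftp (i # p) (j # q)"
  then obtain c k l where "prefix (c @ [k]) (i # p)" "prefix (c @ [l]) (j # q)" "k < l"
    unfolding leftp_def by blast
  then show "i < j \<or> i = j \<and> leftp p q"
    by (cases c) (auto simp: leftp_def)
next
  assume "i < j \<or> i = j \<and> leftp p q"
  then show "leftp (i # p) (j # q)"
  proof
    assume "i < j"
    then have "prefix ([] @ [i]) (i # p) \<and> prefix ([] @ [j]) (j # q) \<and> i < j" by simp
    then show ?thesis unfolding leftp_def by blast
  next
    assume "i = j \<and> leftp p q"
    then obtain c k l where "i = j" "prefix (c @ [k]) p" "prefix (c @ [l]) q" "k < l"
      unfolding leftp_def by blast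
    then have "prefix ((i # c) @ [k]) (i # p) \<and> prefix ((i # c) @ [l]) (j # q) \<and> k < l" by simp
    then show ?thesis unfolding leftp_def by blast
  qed
qed

section \<open>Existence of a reduced tree for given leaves\<close>

lemma reduced_tree_of_iff:
  "reduced (tree_of T) \<longleftrightarrow> (\<forall>p. is_vertex T p \<longrightarrow> card {i. is_vertex T (p @ [i])} \<noteq> 1)"
  unfolding reduced_def tree_of_eq_cover_tree arity_cover_tree[OF prefix_closed_verts] by simp

lemma reduced_Node:
  "reduced (tree_of (Node Ts)) \<longleftrightarrow> length Ts \<noteq> 1 \<and> (\<forall>T\<in>set Ts. reduced (tree_of T))"
proof -
  have all_list: "(\<forall>p. P p) \<longleftrightarrow> P [] \<and> (\<forall>i q. P (i # q))" for P :: "nat list \<Rightarrow> bool"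
    by (metis neq_Nil_conv)
  have "{i. is_vertex (Node Ts) ([] @ [i])} = {..<length Ts}" by auto
  then have root: "card {i. is_vertex (Node Ts) ([] @ [i])} = length Ts" by simp
  show ?thesis
    unfolding reduced_tree_of_iff[of "Node Ts"] all_list[of "\<lambda>p. is_vertex (Node Ts) p \<longrightarrow> _ p"] root
    by (auto simp: reduced_tree_of_iff all_set_conv_all_nth cong: conj_cong)
qed

lemma meets_mono: "I \<subseteq> J \<Longrightarrow> meets I \<subseteq> meets J"
  unfolding meets_def by blast

text \<open>The existence half behind the \<open>THE\<close> in \<open>contract\<close>. The set is
  split by the letter following the common prefix; the pieces are smaller and yield the branches,
  the common prefix becomes the root.\<close>

lemma ex_reduced_order_iso:
  fixes I :: "nat list set"
  assumes "finite I" "I \<noteq> {}" "antichain I"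
  shows "\<exists>S f. reduced (tree_of S) \<and> order_iso f (verts S) (meets I)"
  using assms
proof (induction "card I" arbitrary: I rule: less_induct)
  case less
  show ?case
  proof (cases "\<exists>a. I = {a}")
    case True
    then obtain a where "I = {a}" by blast
    then have "meets I = {a}" by (simp add: meets_def lcp_absorb1)
    moreover have "verts (Node []) = {[]}" by (auto simp: is_vertex_single)
    ultimately have "order_iso (\<lambda>_. a) (verts (Node [])) (meets I)"
      by (intro order_isoI) auto
    moreover have "reduced (tree_of (Node []))" by (simp add: reduced_Node)
    ultimately show ?thesis by blast
  next
    case False
    define c where "c = Longest_common_prefix I"
    define part where "part k = {a \<in> I. prefix (c @ [k]) a}" for k
    define K where "K = {k. part k \<noteq> {}}"
    have c: "prefix c a" if "a \<in> I" for a
      using that Longest_common_prefix_prefix unfolding c_def by blast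
    have ex_part: "\<exists>k. a \<in> part k" if "a \<in> I" for a
    proof -
      have "c \<noteq> a"
      proof
        assume "c = a"
        then have "I = {a}" using c less.prems that unfolding antichain_def by blast
        with False show False by blast
      qed
      then show ?thesis
        using strict_prefix_snoc[OF c[OF that]] that unfolding part_def by blast
    qed
    \<comment> \<open>If only one letter followed \<open>c\<close>, all elements would share a
      longer prefix. Hence there are at least two parts: each is a proper subset of
      \<open>I\<close>, and the new root does not have arity 1.\<close>
    have ex_other: "\<exists>l\<in>K. l \<noteq> k" for k
    proof (rule ccontr)
      assume n: "\<not> (\<exists>l\<in>K. l \<noteq> k)"
      have "prefix (c @ [k]) a" if "a \<in> I" for a
      proof -
        from ex_part[OF that] obtain l where "a \<in> part l" by blast
        moreover from this have "l = k" using n unfolding K_def by blast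
        ultimately show ?thesis unfolding part_def by simp
      qed
      then have "prefix (c @ [k]) c"
        using Longest_common_prefix_max_prefix less.prems unfolding c_def by blast
      then show False by simp
    qed
    have part_disj: "k = l" if "a \<in> part k" "a \<in> part l" for a k l
    proof (rule ccontr)
      assume "k \<noteq> l"
      then have "lcp a a = c" using that unfolding part_def by (intro lcp_diverge[of c k a l]) auto
      then show False using that unfolding part_def by (auto simp: lcp_absorb1)
    qed
    have "finite K"
    proof -
      have "k \<in> (\<lambda>a. a ! length c) ` I" if "k \<in> K" for k
        using that unfolding K_def part_def by (force simp: prefix_def)
      then have "K \<subseteq> (\<lambda>a. a ! length c) ` I" by blast
      then show ?thesis using less.prems finite_surj by blast
    qed
    have "\<exists>S f. reduced (tree_of S) \<and> order_iso f (verts S) (meets (part k))" if "k \<in> K" for k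
    proof (rule less.hyps)
      obtain l where "l \<in> K" "l \<noteq> k" using ex_other by blast
      then obtain a where "a \<in> part l" "a \<notin> part k" using part_disj unfolding K_def by blast
      then have "part k \<subset> I" unfolding part_def by blast
      then show "card (part k) < card I" using less.prems psubset_card_mono by blast
      show "finite (part k)" "antichain (part k)"
        using less.prems unfolding part_def antichain_def by auto
      show "part k \<noteq> {}" using that unfolding K_def by blast
    qed
    then obtain S f where S: "\<And>k. k \<in> K \<Longrightarrow> reduced (tree_of (S k))"
      and f: "\<And>k. k \<in> K \<Longrightarrow> order_iso (f k) (verts (S k)) (meets (part k))"
      by metis
    \<comment> \<open>The letters in \<open>K\<close> may have gaps, whereas children of a
      \<open>Node\<close> are numbered consecutively; the increasing enumeration \<open>ks\<close>
      renumbers them and preserves the left order.\<close>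
    define ks where "ks = sorted_list_of_set K"
    define T where "T = Node (map S ks)"
    \<comment> \<open>No prefix has to be added: the values of \<open>f k\<close> are lists already
      starting with \<open>c @ [k]\<close>.\<close>
    define F where "F p = (case p of [] \<Rightarrow> c | j # q \<Rightarrow> f (ks ! j) q)" for p
    have ks: "set ks = K" "sorted_wrt (<) ks"
      using \<open>finite K\<close> by (auto simp: ks_def)
    have nth: "ks ! j \<in> K" if "j < length ks" for j
      using that ks by auto
    have "length ks \<noteq> 1"
    proof
      assume "length ks = 1"
      then obtain k where "ks = [k]" by (auto simp: length_Suc_conv)
      then show False using ks ex_other[of k] by auto
    qed
    then have "reduced (tree_of T)"
      using S ks by (auto simp: T_def reduced_Node)
    moreover have "order_iso F (verts T) (meets I)"
    proof (rule order_isoI)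
      have pre: "prefix (c @ [k]) p" if "p \<in> meets (part k)" for p k
        using that unfolding meets_def part_def by (auto simp only: prefix_lcp_iff mem_Collect_eq)
      have im: "f k ` verts (S k) = meets (part k)" if "k \<in> K" for k
        using f[OF that] unfolding order_iso_def bij_betw_def by blast
      \<comment> \<open>Elements of different parts meet exactly in \<open>c\<close>; since two
        parts exist, \<open>c\<close> does occur.\<close>
      have meets_I: "meets I = insert c (\<Union>k\<in>K. meets (part k))"
      proof (intro set_eqI iffI)
        fix p assume "p \<in> meets I"
        then obtain a b where ab: "a \<in> I" "b \<in> I" "p = lcp a b" unfolding meets_def by blast
        then obtain k l where kl: "a \<in> part k" "b \<in> part l" using ex_part by blast
        show "p \<in> insert c (\<Union>k\<in>K. meets (part k))"
        proof (cases "k = l")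
          case True
          then show ?thesis using ab kl unfolding meets_def K_def by blast
        next
          case False
          then have "p = c" using kl ab unfolding part_def by (auto intro: lcp_diverge)
          then show ?thesis by simp
        qed
      next
        fix p assume "p \<in> insert c (\<Union>k\<in>K. meets (part k))"
        moreover have "c \<in> meets I"
        proof -
          obtain k where "k \<in> K" using ex_other by blast
          moreover obtain l where "l \<in> K" "l \<noteq> k" using ex_other by blast
          ultimately obtain a b where "a \<in> part k" "b \<in> part l" unfolding K_def by blast
          moreover from this have "lcp a b = c"
            using \<open>l \<noteq> k\<close> lcp_diverge[of c k a l b] unfolding part_def by simp
          ultimately show ?thesis unfolding meets_def part_def by blast
        qed
        moreover have "meets (part k) \<subseteq> meets I" for k
          unfolding part_def by (rule meets_mono) blast
        ultimately show "p \<in> meets I" by blast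
      qed
      have "F ` verts T = insert c (\<Union>j<length ks. f (ks ! j) ` verts (S (ks ! j)))"
      proof (intro set_eqI iffI)
        fix q assume "q \<in> F ` verts T"
        then obtain p where "is_vertex T p" "q = F p" by blast
        then show "q \<in> insert c (\<Union>j<length ks. f (ks ! j) ` verts (S (ks ! j)))"
          by (cases p) (fastforce simp: F_def T_def)+
      next
        fix q assume "q \<in> insert c (\<Union>j<length ks. f (ks ! j) ` verts (S (ks ! j)))"
        then consider "q = c" | j p where "j < length ks" "is_vertex (S (ks ! j)) p" "q = f (ks ! j) p"
          by blast
        then show "q \<in> F ` verts T"
        proof cases
          case 1
          then show ?thesis by (intro image_eqI[of _ _ "[]"]) (auto simp: F_def)
        next
          case 2
          then show ?thesis by (intro image_eqI[of _ _ "j # p"]) (auto simp: F_def T_def)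
        qed
      qed
      also have "\<dots> = insert c (\<Union>k\<in>set ks. meets (part k))"
        using im nth by (auto simp: set_conv_nth)
      finally show "F ` verts T = meets I"
        using ks meets_I by simp
      have ver: "j < length ks \<and> ks ! j \<in> K \<and> is_vertex (S (ks ! j)) p \<and> prefix (c @ [ks ! j]) (f (ks ! j) p)"
        if "j # p \<in> verts T" for j p
      proof -
        have j: "j < length ks" "is_vertex (S (ks ! j)) p" using that by (auto simp: T_def)
        then have "f (ks ! j) p \<in> meets (part (ks ! j))" using im[OF nth] by blast
        with j nth pre show ?thesis by blast
      qed
      fix p q assume pq: "p \<in> verts T" "q \<in> verts T"
      {
        assume "strict_prefix p q"
        then obtain j q' where q: "q = j # q'" by (cases q) auto
        show "strict_prefix (F p) (F q)"
        proof (cases p)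
          case Nil
          have "prefix (c @ [ks ! j]) (F q)" using ver pq q by (simp add: F_def)
          then have "strict_prefix c (F q)"
            by (auto simp: strict_prefix_def dest: append_prefixD)
          then show ?thesis using Nil by (simp add: F_def)
        next
          case (Cons i p')
          then have "i = j" "strict_prefix p' q'"
            using \<open>strict_prefix p q\<close> q by auto
          then show ?thesis
            using ver[of j p'] ver[of j q'] pq q Cons order_iso_strict_prefix[OF f, of "ks ! j" p' q']
            by (simp add: F_def)
        qed
      }
      {
        assume l: "leftp p q"
        then obtain i p' j q' where p: "p = i # p'" and q: "q = j # q'"
          by (cases p; cases q) auto
        show "leftp (F p) (F q)"
        proof (cases "i = j")
          case True
          then show ?thesis
            using l ver[of i p'] ver[of i q'] pq p q f[of "ks ! i"]
            by (simp add: F_def order_iso_def)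
        next
          case False
          then have "ks ! i < ks ! j"
            using l p q ver pq ks(2) by (simp add: sorted_wrt_iff_nth_less)
          then show ?thesis
            using ver pq p q unfolding leftp_def F_def by fastforce
        qed
      }
    qed
    ultimately show ?thesis by blast
  qed
qed

section \<open>What order isomorphisms preserve\<close>

lemma order_iso_comp:
  assumes "order_iso f X Y" "order_iso g Y Z"
  shows "order_iso (g \<circ> f) X Z"
proof -
  have "f p \<in> Y" if "p \<in> X" for p
    using assms(1) that unfolding order_iso_def bij_betw_def by blast
  then show ?thesis
    using assms unfolding order_iso_def by (auto intro: bij_betw_trans)
qed

lemma order_iso_subset:
  assumes "order_iso f X Y" "X' \<subseteq> X"
  shows "order_iso f X' (f ` X')"
  using assms unfolding order_iso_def bij_betw_def by (auto simp: subset_iff intro: inj_on_subset)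

text \<open>In an lcp-closed set the meet is the greatest lower bound within the set, hence
  determined by the order. Closure of \<open>Y\<close> makes the meet of the images an image
  \<open>f e\<close>, and \<open>e\<close> is then a common prefix of \<open>a\<close> and
  \<open>b\<close>.\<close>

lemma order_iso_lcp:
  assumes f: "order_iso f X Y" and X: "lcp_closed X" and Y: "lcp_closed Y" and ab: "a \<in> X" "b \<in> X"
  shows "f (lcp a b) = lcp (f a) (f b)"
proof -
  have pre: "prefix (f p) (f q) \<longleftrightarrow> prefix p q" if "p \<in> X" "q \<in> X" for p q
    using f that unfolding order_iso_def by blast
  have img: "Y = f ` X"
    using f unfolding order_iso_def bij_betw_def by blast
  have m: "lcp a b \<in> X" "lcp (f a) (f b) \<in> Y"
    using X Y ab unfolding lcp_closed_def img by blast+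
  then obtain e where e: "e \<in> X" "lcp (f a) (f b) = f e"
    unfolding img by blast
  have "prefix (f e) (f a)" "prefix (f e) (f b)"
    unfolding e(2)[symmetric] by (rule longest_common_prefix_prefix1 longest_common_prefix_prefix2)+
  then have "prefix (f e) (f (lcp a b))"
    using pre ab e m by (simp add: prefix_lcp_iff)
  moreover have "prefix (f (lcp a b)) (lcp (f a) (f b))"
    using pre ab m
    by (simp add: prefix_lcp_iff longest_common_prefix_prefix1 longest_common_prefix_prefix2)
  ultimately show ?thesis
    unfolding e(2) by (rule prefix_order.antisym[rotated])
qed

lemma order_iso_image_meets:
  assumes f: "order_iso f X Y" and "lcp_closed X" "lcp_closed Y" "J \<subseteq> X"
  shows "f ` meets J = meets (f ` J)"
proof -
  have "f (lcp a b) = lcp (f a) (f b)" if "a \<in> J" "b \<in> J" for a b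
    using order_iso_lcp[OF assms(1-3)] assms(4) that by blast
  then show ?thesis
    unfolding meets_def by (auto simp: image_iff) metis+
qed

text \<open>A description of leaves by the order alone, so that order isomorphisms carry leaves to
  leaves.\<close>

definition maximal :: "'a list set \<Rightarrow> 'a list set" where
  "maximal X = {p \<in> X. \<forall>q\<in>X. prefix p q \<longrightarrow> q = p}"

lemma leaves_tree_of: "leaves (tree_of T) = maximal (verts T)"
proof (intro set_eqI iffI)
  fix p assume p: "p \<in> leaves (tree_of T)"
  have "q = p" if q: "q \<in> verts T" "prefix p q" for q
  proof (rule ccontr)
    assume "q \<noteq> p"
    then obtain i where "prefix (p @ [i]) q"
      using strict_prefix_snoc[of p q] q by metis
    then have "p @ [i] \<in> verts T"
      using prefix_closedD[OF prefix_closed_verts that(1)] by blast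
    then show False using p unfolding mem_leaves_tree_of by blast
  qed
  then show "p \<in> maximal (verts T)"
    using p unfolding mem_leaves_tree_of maximal_def by blast
next
  fix p assume p: "p \<in> maximal (verts T)"
  then have "p @ [i] \<notin> verts T" for i
    unfolding maximal_def by fastforce
  then show "p \<in> leaves (tree_of T)"
    using p unfolding mem_leaves_tree_of maximal_def by blast
qed

text \<open>Recovers \<open>I\<close> from the reduced tree: a meet lies below an element of
  \<open>I\<close> in the prefix order, and the antichain condition prevents elements of
  \<open>I\<close> from being extended.\<close>

lemma maximal_meets:
  assumes "antichain I"
  shows "maximal (meets I) = I"
proof (intro set_eqI iffI)
  fix p assume p: "p \<in> maximal (meets I)"
  then obtain a b where ab: "a \<in> I" "b \<in> I" "p = lcp a b"
    unfolding maximal_def meets_def by blast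
  then have "a \<in> meets I" using subset_meets by blast
  moreover have "prefix p a" using ab longest_common_prefix_prefix1 by blast
  ultimately have "a = p" using p unfolding maximal_def by blast
  with ab(1) show "p \<in> I" by simp
next
  fix a assume a: "a \<in> I"
  have "q = a" if q: "q \<in> meets I" "prefix a q" for q
  proof -
    obtain b where "b \<in> I" "prefix q b"
      using q(1) longest_common_prefix_prefix1 unfolding meets_def by blast
    moreover from this have "a = b"
      using assms a that(2) prefix_order.trans[of a q b] unfolding antichain_def by blast
    ultimately show ?thesis using that(2) \<open>prefix q b\<close> by (simp add: prefix_order.antisym)
  qed
  then show "a \<in> maximal (meets I)"
    using a subset_meets unfolding maximal_def by blast
qed

lemma order_iso_image_maximal:
  assumes "order_iso f X Y"
  shows "f ` maximal X = maximal Y"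
proof -
  have Y: "Y = f ` X" and "inj_on f X"
    and pre: "\<And>p q. p \<in> X \<Longrightarrow> q \<in> X \<Longrightarrow> prefix (f p) (f q) \<longleftrightarrow> prefix p q"
    using assms unfolding order_iso_def bij_betw_def by blast+
  then have eq: "f p = f q \<longleftrightarrow> p = q" if "p \<in> X" "q \<in> X" for p q
    using that by (auto dest: inj_onD)
  show ?thesis
    unfolding maximal_def Y using pre eq by auto
qed

section \<open>Iterated contraction\<close>

lemma finite_verts: "finite (verts T)"
proof (induction T)
  case (Node Ts)
  have "verts (Node Ts) \<subseteq> insert [] (\<Union>i<length Ts. (#) i ` verts (Ts ! i))"
  proof
    fix p assume "p \<in> verts (Node Ts)"
    then show "p \<in> insert [] (\<Union>i<length Ts. (#) i ` verts (Ts ! i))"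
      by (cases p) auto
  qed
  moreover have "finite (\<Union>i<length Ts. (#) i ` verts (Ts ! i))"
    using Node.IH by auto
  ultimately show ?case by (meson finite.insertI finite_subset)
qed

lemma finite_leaves: "finite (leaves (tree_of T))"
  using finite_verts[of T] by (rule finite_subset[rotated]) (auto simp: mem_leaves_tree_of)

lemma finite_leaves': "finite (leaves' V)"
  by (cases V) (auto simp: finite_leaves)

text \<open>An order isomorphism witnesses the defining property; any other candidate shares the
  target and equals \<open>S\<close> by rigidity. From here on the \<open>THE\<close> need not be
  unfolded.\<close>

lemma contract_eqI:
  assumes "I \<subseteq> leaves (tree_of (ptree_of_prt V))" "I \<noteq> {}"
    and "order_iso f (verts (ptree_of_prt S)) (meets I)"
  shows "contract (Some V) I = Some S"
proof -
  let ?R = "Red (span_tree (tree_of (ptree_of_prt V)) I)"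
  have iso: "planar_iso (tree_of (ptree_of_prt S)) ?R"
    unfolding Red_span_tree_of[OF assms(1,2)] unfolding tree_of_eq_cover_tree
    using assms(3) by (rule order_iso_planar_iso[where r = "[]"]) auto
  have "S' = S" if "planar_iso (tree_of (ptree_of_prt S')) ?R" for S'
  proof -
    have "root_of (tree_of T) \<in> vertices (tree_of T)" for T by (simp add: tree_of_def)
    then have "planar_iso (tree_of (ptree_of_prt S')) (tree_of (ptree_of_prt S))"
      using planar_iso_common_target that iso by blast
    then show ?thesis
      using planar_iso_tree_of_imp_eq ptree_of_prt_inject by blast
  qed
  then have "(THE S. planar_iso (tree_of (ptree_of_prt S)) ?R) = S"
    using iso by (intro the_equality)
  then show ?thesis using assms(2) by simp
qed

lemma contract_SomeE:
  assumes "I \<subseteq> leaves (tree_of (ptree_of_prt V))" "I \<noteq> {}"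
  obtains S f where "contract (Some V) I = Some S" "order_iso f (verts (ptree_of_prt S)) (meets I)"
proof -
  have "finite I" using assms(1) finite_leaves finite_subset by blast
  moreover have "antichain I"
    using antichain_leaves[of "ptree_of_prt V"] assms(1) unfolding antichain_def by blast
  ultimately obtain T f where T: "reduced (tree_of T)" "order_iso f (verts T) (meets I)"
    using ex_reduced_order_iso assms(2) by blast
  then have "ptree_of_prt (Abs_prt T) = T"
    by (simp add: Abs_prt_inverse)
  then show thesis
    using that[of "Abs_prt T" f] contract_eqI[OF assms] T by simp
qed

lemma contract_empty [simp]: "contract V {} = None"
  by (cases V) auto

text \<open>Transitivity of contraction. The isomorphism from \<open>T|I\<close> onto
  \<open>meets I\<close> sends leaves, as maximal elements, onto \<open>I\<close>, and sends the
  meets of \<open>J\<close> to the meets of the image of \<open>J\<close>.\<close>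

lemma contract_contract:
  assumes "I \<subseteq> leaves' V"
  obtains \<phi> where "bij_betw \<phi> (leaves' (contract V I)) I"
    "\<And>J. J \<subseteq> leaves' (contract V I) \<Longrightarrow> contract (contract V I) J = contract V (\<phi> ` J)"
proof (cases "I = {}")
  case True
  \<comment> \<open>The contraction is the empty tree, which has no leaves, so any map
    serves.\<close>
  then show thesis by (intro that[of id]) auto
next
  case False
  with assms obtain U where V: "V = Some U" by (cases V) auto
  then have I: "I \<subseteq> leaves (tree_of (ptree_of_prt U))" using assms by simp
  obtain S f where S: "contract V I = Some S" and f: "order_iso f (verts (ptree_of_prt S)) (meets I)"
    using contract_SomeE[OF I False] V by blast
  have "antichain I"
    using antichain_leaves[of "ptree_of_prt U"] I unfolding antichain_def by blast
  then have im: "f ` leaves (tree_of (ptree_of_prt S)) = I"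
    using order_iso_image_maximal[OF f] by (simp add: leaves_tree_of maximal_meets)
  have sub: "leaves (tree_of (ptree_of_prt S)) \<subseteq> verts (ptree_of_prt S)"
    by (auto simp: mem_leaves_tree_of)
  show thesis
  proof (rule that[of f])
    show "bij_betw f (leaves' (contract V I)) I"
      using f sub im unfolding order_iso_def bij_betw_def S by (auto intro: inj_on_subset)
  next
    fix J assume "J \<subseteq> leaves' (contract V I)"
    then have J: "J \<subseteq> leaves (tree_of (ptree_of_prt S))" by (simp add: S)
    show "contract (contract V I) J = contract V (f ` J)"
    proof (cases "J = {}")
      case False
      obtain R g where R: "contract (Some S) J = Some R" and g: "order_iso g (verts (ptree_of_prt R)) (meets J)"
        using contract_SomeE[OF J False] by blast
      have JS: "J \<subseteq> verts (ptree_of_prt S)" using J sub by blast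
      note closed = prefix_closed_imp_lcp_closed[OF prefix_closed_verts]
      \<comment> \<open>Composed with \<open>g\<close>, this exhibits \<open>R\<close> as the
        reduced tree of the image of \<open>J\<close>, which is what \<open>contract_eqI\<close>
        asks for.\<close>
      have "order_iso f (meets J) (f ` meets J)"
        using f meets_subset[OF closed JS] by (rule order_iso_subset)
      also have "f ` meets J = meets (f ` J)"
        using order_iso_image_meets[OF f closed lcp_closed_meets JS] .
      finally have "order_iso (f \<circ> g) (verts (ptree_of_prt R)) (meets (f ` J))"
        by (rule order_iso_comp[OF g])
      moreover have "f ` J \<subseteq> leaves (tree_of (ptree_of_prt U))"
        using I im J by blast
      ultimately have "contract (Some U) (f ` J) = Some R"
        using False by (intro contract_eqI) auto
      then show ?thesis using R S V by simp
    qed simp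
  qed
qed

section \<open>Trees with few leaves\<close>

lemma leaves_Node:
  "leaves (tree_of (Node Ts)) = (if Ts = [] then {[]} else (\<Union>i<length Ts. (#) i ` leaves (tree_of (Ts ! i))))"
  (is "?L = ?R")
proof (rule set_eqI)
  fix p show "p \<in> ?L \<longleftrightarrow> p \<in> ?R"
  proof (cases p)
    case Nil
    then show ?thesis by (auto simp: mem_leaves_tree_of)
  next
    case (Cons i q)
    have "i # q \<in> ?L \<longleftrightarrow> i < length Ts \<and> q \<in> leaves (tree_of (Ts ! i))"
      by (auto simp: mem_leaves_tree_of)
    also have "\<dots> \<longleftrightarrow> i # q \<in> ?R" by auto
    finally show ?thesis unfolding Cons .
  qed
qed

lemma leaves_nonempty: "leaves (tree_of T) \<noteq> {}"
proof (induction T)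
  case (Node Ts)
  show ?case
  proof (cases Ts)
    case (Cons T Ts')
    then have "leaves (tree_of (Ts ! 0)) \<noteq> {}" using Node.IH[of T] by simp
    then show ?thesis using Cons by (simp add: leaves_Node) (metis lessThan_iff nth_Cons_0 zero_less_Suc)
  qed (simp add: leaves_Node)
qed

lemma card_leaves_Node:
  assumes "Ts \<noteq> []"
  shows "card (leaves (tree_of (Node Ts))) = (\<Sum>i<length Ts. card (leaves (tree_of (Ts ! i))))"
proof -
  have "card (\<Union>i<length Ts. (#) i ` leaves (tree_of (Ts ! i))) = (\<Sum>i<length Ts. card ((#) i ` leaves (tree_of (Ts ! i))))"
    by (rule card_UN_disjoint) (auto simp: finite_leaves)
  then show ?thesis
    using assms by (simp add: leaves_Node card_image)
qed

text \<open>Every branch has a leaf and the root of a larger reduced tree has at least two branches,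
  so each branch has fewer leaves than the whole and the number of branches is bounded by the
  degree.\<close>

lemma finite_reduced_leaves:
  "finite {T. reduced (tree_of T) \<and> card (leaves (tree_of T)) \<le> n}" (is "finite (?R n)")
proof (induction n)
  case 0
  have "?R 0 = {}" using leaves_nonempty finite_leaves by auto
  then show ?case by (simp only: finite.emptyI)
next
  case (Suc n)
  have pos: "card (leaves (tree_of T)) \<ge> 1" for T
    using leaves_nonempty finite_leaves by (simp add: Suc_le_eq card_gt_0_iff)
  have "?R (Suc n) \<subseteq> insert (Node []) (Node ` {Ts. set Ts \<subseteq> ?R n \<and> length Ts \<le> Suc n})"
  proof
    fix T assume T: "T \<in> ?R (Suc n)"
    obtain Ts where Ts: "T = Node Ts" by (cases T)
    show "T \<in> insert (Node []) (Node ` {Ts. set Ts \<subseteq> ?R n \<and> length Ts \<le> Suc n})"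
    proof (cases "Ts = []")
      case False
      let ?c = "\<lambda>i. card (leaves (tree_of (Ts ! i)))"
      have red: "length Ts \<noteq> 1" "\<And>T. T \<in> set Ts \<Longrightarrow> reduced (tree_of T)"
        using T Ts by (auto simp: reduced_Node)
      have le: "(\<Sum>i<length Ts. ?c i) \<le> Suc n"
        using T card_leaves_Node[OF False] by (simp add: Ts)
      have "(\<Sum>i<length Ts. 1) \<le> (\<Sum>i<length Ts. ?c i)"
        by (intro sum_mono pos)
      with le have "length Ts \<le> Suc n" by simp
      moreover have "?c i \<le> n" if i: "i < length Ts" for i
      proof -
        \<comment> \<open>A second branch exists because the number of branches is neither 0 nor 1;
          its leaf is missing from branch \<open>i\<close>.\<close>
        obtain j where j: "j < length Ts" "j \<noteq> i"
          using red(1) i by (metis One_nat_def less_one linorder_neqE_nat not_less_eq less_Suc_eq)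
        have "?c i + ?c j = (\<Sum>k\<in>{i, j}. ?c k)" using j by simp
        also have "\<dots> \<le> (\<Sum>i<length Ts. ?c i)" using i j by (intro sum_mono2) auto
        finally show ?thesis using le pos[of "Ts ! j"] by simp
      qed
      then have "set Ts \<subseteq> ?R n"
        using red(2) by (auto simp: in_set_conv_nth)
      ultimately show ?thesis
        unfolding Ts by blast
    qed (simp add: Ts)
  qed
  moreover have "finite {Ts. set Ts \<subseteq> ?R n \<and> length Ts \<le> Suc n}"
    using Suc by (rule finite_lists_length_le)
  ultimately show ?case
    by (meson finite.insertI finite_imageI finite_subset)
qed

lemma finite_prt_leaves: "finite {V. card (leaves' V) \<le> n}"
proof -
  have "finite (ptree_of_prt ` {T. card (leaves (tree_of (ptree_of_prt T))) \<le> n})"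
    using finite_reduced_leaves[of n]
    by (rule finite_subset[rotated]) (use ptree_of_prt in auto)
  then have "finite {T. card (leaves (tree_of (ptree_of_prt T))) \<le> n}"
    by (rule finite_imageD) (simp add: inj_on_def ptree_of_prt_inject)
  moreover have "{V. card (leaves' V) \<le> n} = insert None (Some ` {T. card (leaves (tree_of (ptree_of_prt T))) \<le> n})"
  proof (rule set_eqI)
    fix V show "V \<in> {V. card (leaves' V) \<le> n} \<longleftrightarrow> V \<in> insert None (Some ` {T. card (leaves (tree_of (ptree_of_prt T))) \<le> n})"
      by (cases V) auto
  qed
  ultimately show ?thesis by simp
qed

section \<open>Counting\<close>

lemma card_leaves_contract:
  assumes "I \<subseteq> leaves' V"
  shows "card (leaves' (contract V I)) = card I"
  using contract_contract[OF assms] bij_betw_same_card by metis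

text \<open>Additivity of the degree, which bounds the support of a shuffle product.\<close>

lemma card_leaves_N:
  assumes "N S T V \<noteq> {}"
  shows "card (leaves' V) = card (leaves' S) + card (leaves' T)"
proof -
  obtain I where I: "I \<subseteq> leaves' V" "contract V I = S" "contract V (leaves' V - I) = T"
    using assms by (auto simp: N_def)
  have "card (leaves' V) = card I + card (leaves' V - I)"
    using I(1) finite_leaves'[of V] by (simp add: card_Diff_subset card_mono finite_subset)
  then show ?thesis
    using card_leaves_contract[of I V] card_leaves_contract[of "leaves' V - I" V] I by simp
qed

lemma planar_shuffle_eq_sum:
  assumes "finite A" "\<And>V. N S T V \<noteq> {} \<Longrightarrow> V \<in> A"
  shows "(planar_shuffle S T :: 'k::field tree_poly) =
    (\<Sum>V\<in>A. scale (of_nat (card (N S T V))) (tree_basis V))"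
  unfolding planar_shuffle_def
proof (rule Sum_any.expand_superset)
  show "{V. scale (of_nat (card (N S T V))) (tree_basis V :: 'k tree_poly) \<noteq> 0} \<subseteq> A"
  proof
    fix V assume "V \<in> {V. scale (of_nat (card (N S T V))) (tree_basis V :: 'k tree_poly) \<noteq> 0}"
    then have "N S T V \<noteq> {}"
      by (auto simp: poly_mapping_eq_iff fun_eq_iff)
    then show "V \<in> A" by (rule assms(2))
  qed
qed (fact assms(1))

lemma lookup_tree_basis: "Poly_Mapping.lookup (tree_basis V) W = (if V = W then 1 else 0)"
  by (simp add: tree_basis_def lookup_single when_def)

lemma lookup_planar_shuffle:
  "Poly_Mapping.lookup (planar_shuffle S T :: 'k::field tree_poly) V = of_nat (card (N S T V))"
proof -
  \<comment> \<open>\<open>V\<close> is inserted so that its coefficient can be read off even when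
    its degree is too large.\<close>
  define A where "A = insert V {V. card (leaves' V) \<le> card (leaves' S) + card (leaves' T)}"
  have "finite A" unfolding A_def using finite_prt_leaves by simp
  moreover have "U \<in> A" if "N S T U \<noteq> {}" for U
    using card_leaves_N[OF that] by (simp add: A_def)
  ultimately have "(planar_shuffle S T :: 'k tree_poly) =
      (\<Sum>V\<in>A. scale (of_nat (card (N S T V))) (tree_basis V))"
    by (rule planar_shuffle_eq_sum)
  moreover have "V \<in> A" by (simp add: A_def)
  ultimately show ?thesis
    using \<open>finite A\<close> by (simp add: lookup_sum lookup_tree_basis if_distrib[of "(*) _"] sum.delta cong: if_cong)
qed

text \<open>Passing to the complement exchanges the two contractions.\<close>

lemma card_N_commute: "card (N S T V) = card (N T S V)"
proof -
  have "bij_betw (\<lambda>I. leaves' V - I) (N S T V) (N T S V)"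
    by (rule bij_betw_byWitness[where f' = "\<lambda>I. leaves' V - I"])
      (auto simp: N_def double_diff)
  then show ?thesis by (rule bij_betw_same_card)
qed

lemma planar_shuffle_commute: "planar_shuffle S T = (planar_shuffle T S :: 'k::field tree_poly)"
  by (rule poly_mapping_eqI) (simp add: lookup_planar_shuffle card_N_commute[of S T])

text \<open>Ordered partitions of the leaves into three possibly empty blocks; the third block is
  stored only as the complement of \<open>I\<close> and \<open>J\<close>.\<close>

definition triples :: "prt option \<Rightarrow> prt option \<Rightarrow> prt option \<Rightarrow> prt option \<Rightarrow> (nat list set \<times> nat list set) set" where
  "triples S T U W = {(I, J). I \<subseteq> leaves' W \<and> J \<subseteq> leaves' W \<and> I \<inter> J = {} \<and>
     contract W I = S \<and> contract W J = T \<and> contract W (leaves' W - (I \<union> J)) = U}"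

lemma card_triples_rotate: "card (triples S T U W) = card (triples T U S W)"
proof -
  have compl: "leaves' W - (J \<union> (leaves' W - (I \<union> J))) = I"
    if "I \<subseteq> leaves' W" "J \<subseteq> leaves' W" "I \<inter> J = {}" for I J
    using that by blast
  have compl': "leaves' W - (leaves' W - (I \<union> J) \<union> I) = J"
    if "I \<subseteq> leaves' W" "J \<subseteq> leaves' W" "I \<inter> J = {}" for I J
    using that by blast
  have "bij_betw (\<lambda>(I, J). (J, leaves' W - (I \<union> J))) (triples S T U W) (triples T U S W)"
    by (rule bij_betw_byWitness[where f' = "\<lambda>(I, J). (leaves' W - (I \<union> J), I)"])
      (auto simp: triples_def compl compl')
  then show ?thesis by (rule bij_betw_same_card)
qed

text \<open>By transitivity of contraction, splittings of the leaves of \<open>W|K\<close> become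
  splittings of \<open>K\<close> itself, with contractions taken in \<open>W\<close>.\<close>

lemma card_N_contract:
  assumes "K \<subseteq> leaves' W"
  shows "card (N S T (contract W K)) = card {I. I \<subseteq> K \<and> contract W I = S \<and> contract W (K - I) = T}"
proof -
  obtain \<phi> where bij: "bij_betw \<phi> (leaves' (contract W K)) K"
    and \<phi>: "\<And>J. J \<subseteq> leaves' (contract W K) \<Longrightarrow> contract (contract W K) J = contract W (\<phi> ` J)"
    using contract_contract[OF assms] by blast
  let ?L = "leaves' (contract W K)" and ?B = "{I. I \<subseteq> K \<and> contract W I = S \<and> contract W (K - I) = T}"
  have inj: "inj_on \<phi> ?L" and im: "\<phi> ` ?L = K"
    using bij by (auto simp: bij_betw_def)
  have diff: "\<phi> ` (?L - J) = K - \<phi> ` J" if "J \<subseteq> ?L" for J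
    using inj_on_image_set_diff[OF inj _ that, of ?L] im by simp
  have "(`) \<phi> ` N S T (contract W K) = ?B"
  proof (intro set_eqI iffI)
    fix I assume "I \<in> (`) \<phi> ` N S T (contract W K)"
    then obtain J where J: "J \<in> N S T (contract W K)" "I = \<phi> ` J" by blast
    moreover from this have "J \<subseteq> ?L" by (simp add: N_def)
    moreover from this have "\<phi> ` J \<subseteq> K" using im by blast
    ultimately show "I \<in> ?B"
      using \<phi>[of J] \<phi>[of "?L - J"] diff[of J] by (simp add: N_def)
  next
    fix I assume I: "I \<in> ?B"
    then obtain J where J: "J \<subseteq> ?L" "I = \<phi> ` J"
      using im by (metis (lifting) mem_Collect_eq subset_imageE)
    then have "J \<in> N S T (contract W K)"
      using \<phi>[of J] \<phi>[of "?L - J"] diff[of J] I by (auto simp: N_def)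
    then show "I \<in> (`) \<phi> ` N S T (contract W K)" using J by blast
  qed
  moreover have "inj_on ((`) \<phi>) (N S T (contract W K))"
    by (rule inj_on_subset[OF inj_on_image_Pow[OF inj]]) (auto simp: N_def)
  ultimately show ?thesis
    using card_image by metis
qed

text \<open>A partition into \<open>I\<close>, \<open>J\<close> and the rest is a choice of
  \<open>K\<close>, the union of \<open>I\<close> and \<open>J\<close>, followed by a splitting of
  \<open>K\<close>. Grouping by the tree \<open>V = contract W K\<close> produces the sum of
  products.\<close>

lemma card_triples:
  assumes "finite A" "\<And>V. card (leaves' V) \<le> card (leaves' W) \<Longrightarrow> V \<in> A"
  shows "card (triples S T U W) = (\<Sum>V\<in>A. card (N S T V) * card (N V U W))"
proof -
  let ?L = "leaves' W"
  define \<K> where "\<K> = {K. K \<subseteq> ?L \<and> contract W (?L - K) = U}"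
  define B where "B K = {I. I \<subseteq> K \<and> contract W I = S \<and> contract W (K - I) = T}" for K
  have fin: "finite \<K>"
    by (rule finite_subset[of _ "Pow ?L"]) (auto simp: \<K>_def finite_leaves')
  have finB: "finite (B K)" if "K \<in> \<K>" for K
  proof (rule finite_subset)
    show "B K \<subseteq> Pow ?L" using that unfolding B_def \<K>_def by blast
  qed (simp add: finite_leaves')
  have "bij_betw (\<lambda>(I, J). (I \<union> J, I)) (triples S T U W) (Sigma \<K> B)"
  proof (rule bij_betw_byWitness[where f' = "\<lambda>(K, I). (I, K - I)"])
    show "\<forall>a\<in>triples S T U W. (\<lambda>(K, I). (I, K - I)) ((\<lambda>(I, J). (I \<union> J, I)) a) = a"
      by (auto simp: triples_def)
    show "\<forall>a\<in>Sigma \<K> B. (\<lambda>(I, J). (I \<union> J, I)) ((\<lambda>(K, I). (I, K - I)) a) = a"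
      by (auto simp: B_def)
    have "(I \<union> J) - I = J" if "I \<inter> J = {}" for I J :: "nat list set"
      using that by blast
    then show "(\<lambda>(I, J). (I \<union> J, I)) ` triples S T U W \<subseteq> Sigma \<K> B"
      by (auto simp: triples_def \<K>_def B_def)
    have "I \<union> (K - I) = K" if "I \<subseteq> K" for I K :: "nat list set"
      using that by blast
    then show "(\<lambda>(K, I). (I, K - I)) ` Sigma \<K> B \<subseteq> triples S T U W"
      by (auto simp: triples_def \<K>_def B_def)
        (auto dest: subsetD)
  qed
  then have "card (triples S T U W) = card (Sigma \<K> B)"
    by (rule bij_betw_same_card)
  also have "\<dots> = (\<Sum>K\<in>\<K>. card (B K))"
    using fin finB by (simp add: card_SigmaI)
  also have "\<dots> = (\<Sum>K\<in>\<K>. card (N S T (contract W K)))"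
    by (intro sum.cong refl) (simp add: card_N_contract B_def \<K>_def)
  also have "\<dots> = (\<Sum>V\<in>A. \<Sum>K | K \<in> \<K> \<and> contract W K = V. card (N S T (contract W K)))"
  proof (rule sum.group[symmetric, OF fin assms(1)])
    \<comment> \<open>Contraction cannot raise the degree, so every intermediate tree
      \<open>V\<close> lies in \<open>A\<close>.\<close>
    have "card (leaves' (contract W K)) \<le> card ?L" if "K \<in> \<K>" for K
      using that card_leaves_contract[of K W] card_mono[OF finite_leaves'[of W], of K]
      by (auto simp: \<K>_def)
    then show "contract W ` \<K> \<subseteq> A" using assms(2) by blast
  qed
  also have "\<dots> = (\<Sum>V\<in>A. card (N S T V) * card (N V U W))"
  proof (intro sum.cong refl)
    fix V
    have "{K. K \<in> \<K> \<and> contract W K = V} = N V U W"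
      by (auto simp: \<K>_def N_def)
    moreover have "(\<Sum>K | K \<in> \<K> \<and> contract W K = V. card (N S T (contract W K)))
        = (\<Sum>K | K \<in> \<K> \<and> contract W K = V. card (N S T V))"
      by (intro sum.cong) auto
    ultimately show "(\<Sum>K | K \<in> \<K> \<and> contract W K = V. card (N S T (contract W K))) = card (N S T V) * card (N V U W)"
      by simp
  qed
  finally show ?thesis .
qed

section \<open>The bilinear extension\<close>

lemma linear_scale_iff:
  "Vector_Spaces.linear scale scale (h :: 'k::field tree_poly \<Rightarrow> 'k tree_poly) \<longleftrightarrow>
     (\<forall>f g. h (f + g) = h f + h g) \<and> (\<forall>c f. h (scale c f) = scale c (h f))"
  using vector_space_scale by (auto simp: Vector_Spaces.linear_iff)

lemma linear_scale_sum:
  assumes "Vector_Spaces.linear scale scale (h :: 'k::field tree_poly \<Rightarrow> 'k tree_poly)"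
  shows "h (\<Sum>i\<in>A. scale (c i) (f i)) = (\<Sum>i\<in>A. scale (c i) (h (f i)))"
proof -
  interpret Vector_Spaces.linear scale scale h by (fact assms)
  show ?thesis by (simp add: sum scale)
qed

lemma tree_poly_expand:
  assumes "finite A" "Poly_Mapping.keys f \<subseteq> A"
  shows "(f :: 'k::field tree_poly) = (\<Sum>V\<in>A. scale (Poly_Mapping.lookup f V) (tree_basis V))"
proof (rule poly_mapping_eqI)
  fix W
  show "Poly_Mapping.lookup f W =
      Poly_Mapping.lookup (\<Sum>V\<in>A. scale (Poly_Mapping.lookup f V) (tree_basis V)) W"
    using assms
    by (auto simp: lookup_sum lookup_tree_basis if_distrib[of "(*) _"] sum.delta in_keys_iff cong: if_cong)
qed

text \<open>A bilinear map is determined by its values on pairs of basis trees; this gives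
  uniqueness.\<close>

lemma bilinear_map_expand:
  assumes B: "bilinear_map (B :: 'k::field tree_poly \<Rightarrow> 'k tree_poly \<Rightarrow> 'k tree_poly)"
  shows "B f g = (\<Sum>S\<in>Poly_Mapping.keys f. \<Sum>T\<in>Poly_Mapping.keys g.
    scale (Poly_Mapping.lookup f S * Poly_Mapping.lookup g T) (B (tree_basis S) (tree_basis T)))"
proof -
  interpret vector_space "scale :: 'k \<Rightarrow> 'k tree_poly \<Rightarrow> 'k tree_poly" by (rule vector_space_scale)
  have lin: "Vector_Spaces.linear scale scale (\<lambda>g. B f g)" "Vector_Spaces.linear scale scale (\<lambda>f. B f g)" for f g
    using B by (auto simp: bilinear_map_def)
  have "B f g = B (\<Sum>S\<in>Poly_Mapping.keys f. scale (Poly_Mapping.lookup f S) (tree_basis S)) g"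
    by (simp flip: tree_poly_expand)
  also have "\<dots> = (\<Sum>S\<in>Poly_Mapping.keys f. scale (Poly_Mapping.lookup f S) (B (tree_basis S) g))"
    by (rule linear_scale_sum[OF lin(2)])
  also have "\<dots> = (\<Sum>S\<in>Poly_Mapping.keys f. scale (Poly_Mapping.lookup f S)
      (B (tree_basis S) (\<Sum>T\<in>Poly_Mapping.keys g. scale (Poly_Mapping.lookup g T) (tree_basis T))))"
    by (simp flip: tree_poly_expand)
  also have "\<dots> = (\<Sum>S\<in>Poly_Mapping.keys f. \<Sum>T\<in>Poly_Mapping.keys g.
    scale (Poly_Mapping.lookup f S * Poly_Mapping.lookup g T) (B (tree_basis S) (tree_basis T)))"
    by (simp only: linear_scale_sum[OF lin(1)] scale_sum_right scale_scale)
  finally show ?thesis .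
qed

definition tree_shuffle :: "'k::field tree_poly \<Rightarrow> 'k tree_poly \<Rightarrow> 'k tree_poly" where
  "tree_shuffle f g = (\<Sum>S\<in>Poly_Mapping.keys f. \<Sum>T\<in>Poly_Mapping.keys g.
     scale (Poly_Mapping.lookup f S * Poly_Mapping.lookup g T) (planar_shuffle S T))"

text \<open>Cancellation may shrink the keys of a sum; a common finite index set allows additivity
  to be checked termwise.\<close>

lemma tree_shuffle_superset:
  fixes f g :: "'k::field tree_poly"
  assumes "finite A" "Poly_Mapping.keys f \<subseteq> A" "finite B" "Poly_Mapping.keys g \<subseteq> B"
  shows "tree_shuffle f g = (\<Sum>S\<in>A. \<Sum>T\<in>B.
     scale (Poly_Mapping.lookup f S * Poly_Mapping.lookup g T) (planar_shuffle S T))"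
proof -
  interpret vector_space "scale :: 'k \<Rightarrow> 'k tree_poly \<Rightarrow> 'k tree_poly" by (rule vector_space_scale)
  have "tree_shuffle f g = (\<Sum>S\<in>Poly_Mapping.keys f. \<Sum>T\<in>B.
     scale (Poly_Mapping.lookup f S * Poly_Mapping.lookup g T) (planar_shuffle S T))"
    unfolding tree_shuffle_def using assms(3,4)
    by (intro sum.cong refl sum.mono_neutral_left) (auto simp: in_keys_iff)
  also have "\<dots> = (\<Sum>S\<in>A. \<Sum>T\<in>B.
     scale (Poly_Mapping.lookup f S * Poly_Mapping.lookup g T) (planar_shuffle S T))"
    using assms(1,2) by (intro sum.mono_neutral_left) (auto simp: in_keys_iff)
  finally show ?thesis .
qed

lemma tree_shuffle_commute: "tree_shuffle f g = tree_shuffle g f"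
  unfolding tree_shuffle_def
  by (subst sum.swap) (simp only: planar_shuffle_commute mult.commute)

lemma linear_tree_shuffle:
  "Vector_Spaces.linear scale scale (\<lambda>g :: 'k::field tree_poly. tree_shuffle f g)"
proof -
  interpret vector_space "scale :: 'k \<Rightarrow> 'k tree_poly \<Rightarrow> 'k tree_poly" by (rule vector_space_scale)
  note super = tree_shuffle_superset[OF finite_keys order_refl]
  have "tree_shuffle f (g + h) = tree_shuffle f g + tree_shuffle f h" for g h
  proof -
    let ?B = "Poly_Mapping.keys g \<union> Poly_Mapping.keys h"
    show ?thesis
      using super[of ?B "g + h" f] super[of ?B g f] super[of ?B h f] Poly_Mapping.keys_add[of g h]
      by (simp add: lookup_add distrib_left scale_left_distrib sum.distrib)
  qed
  moreover have "tree_shuffle f (scale c g) = scale c (tree_shuffle f g)" for c g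
  proof -
    have "Poly_Mapping.keys (scale c g) \<subseteq> Poly_Mapping.keys g"
      by (auto simp: in_keys_iff)
    then show ?thesis
      using super[of "Poly_Mapping.keys g" "scale c g" f] super[of "Poly_Mapping.keys g" g f]
      by (simp add: scale_sum_right ac_simps)
  qed
  ultimately show ?thesis by (simp add: linear_scale_iff)
qed

lemma bilinear_tree_shuffle: "bilinear_map tree_shuffle"
  unfolding bilinear_map_def
proof (intro conjI allI)
  fix g :: "'a tree_poly"
  show "Vector_Spaces.linear scale scale (\<lambda>f. tree_shuffle f g)"
    unfolding tree_shuffle_commute[of _ g] by (rule linear_tree_shuffle)
qed (rule linear_tree_shuffle)

lemma tree_shuffle_basis:
  "tree_shuffle (tree_basis S) (tree_basis T) = (planar_shuffle S T :: 'k::field tree_poly)"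
proof -
  interpret vector_space "scale :: 'k \<Rightarrow> 'k tree_poly \<Rightarrow> 'k tree_poly" by (rule vector_space_scale)
  show ?thesis
    by (simp add: tree_shuffle_def tree_basis_def)
qed

lemma bilinear_map_unique:
  assumes "bilinear_map B" "\<And>S T. B (tree_basis S) (tree_basis T) = planar_shuffle S T"
  shows "B = tree_shuffle"
  by (intro ext) (subst bilinear_map_expand[OF assms(1)], simp only: assms(2) tree_shuffle_def)

text \<open>Expands the inner product over its finite support, after which the coefficient is the
  sum in \<open>card_triples\<close>.\<close>

lemma lookup_tree_shuffle_planar_shuffle:
  "Poly_Mapping.lookup (tree_shuffle (planar_shuffle S T) (tree_basis U) :: 'k::field tree_poly) W
    = of_nat (card (triples S T U W))"
proof -
  \<comment> \<open>The bound adds all three degrees so that \<open>A\<close> contains both the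
    support of the inner product and every tree of degree at most that of \<open>W\<close>.\<close>
  define A where "A = {V. card (leaves' V) \<le> card (leaves' S) + card (leaves' T) + card (leaves' W)}"
  have A: "finite A" "\<And>V. card (leaves' V) \<le> card (leaves' W) \<Longrightarrow> V \<in> A"
    "\<And>V. N S T V \<noteq> {} \<Longrightarrow> V \<in> A"
    unfolding A_def using finite_prt_leaves card_leaves_N by auto
  have lin: "Vector_Spaces.linear scale scale (\<lambda>f :: 'k tree_poly. tree_shuffle f g)" for g
    using bilinear_tree_shuffle unfolding bilinear_map_def by blast
  have "(tree_shuffle (planar_shuffle S T) (tree_basis U) :: 'k tree_poly)
      = (\<Sum>V\<in>A. scale (of_nat (card (N S T V))) (planar_shuffle V U))"
    by (subst planar_shuffle_eq_sum[OF A(1,3)], assumption)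
      (simp only: linear_scale_sum[OF lin] tree_shuffle_basis)
  then show ?thesis
    by (simp add: lookup_sum lookup_planar_shuffle card_triples[OF A(1,2)])
qed

text \<open>Both sides are trilinear, so invariance of \<open>triples\<close> under rotation on
  basis trees is enough; the rest reorders finite sums.\<close>

lemma tree_shuffle_rotate:
  fixes f g h :: "'k::field tree_poly"
  shows "tree_shuffle (tree_shuffle f g) h = tree_shuffle (tree_shuffle g h) f"
proof -
  have lin: "Vector_Spaces.linear scale scale (\<lambda>f :: 'k tree_poly. tree_shuffle f g)"
    "Vector_Spaces.linear scale scale (\<lambda>g :: 'k tree_poly. tree_shuffle f g)" for f g
    using bilinear_tree_shuffle unfolding bilinear_map_def by blast+
  interpret vector_space "scale :: 'k \<Rightarrow> 'k tree_poly \<Rightarrow> 'k tree_poly" by (rule vector_space_scale)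
  let ?l = Poly_Mapping.lookup
  define t where "t S T U = (tree_shuffle (planar_shuffle S T) (tree_basis U) :: 'k tree_poly)" for S T U
  have expand: "tree_shuffle (tree_shuffle f g) h =
      (\<Sum>S\<in>Poly_Mapping.keys f. \<Sum>T\<in>Poly_Mapping.keys g. \<Sum>U\<in>Poly_Mapping.keys h.
        scale (?l f S * ?l g T * ?l h U) (t S T U))" for f g h :: "'k tree_poly"
  proof -
    interpret L: Vector_Spaces.linear scale scale "\<lambda>f :: 'k tree_poly. tree_shuffle f h" by (rule lin)
    have "tree_shuffle (planar_shuffle S T) h = (\<Sum>U\<in>Poly_Mapping.keys h. scale (?l h U) (t S T U))" for S T
    proof -
      have "tree_shuffle (planar_shuffle S T) h =
          tree_shuffle (planar_shuffle S T) (\<Sum>U\<in>Poly_Mapping.keys h. scale (?l h U) (tree_basis U))"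
        by (simp flip: tree_poly_expand)
      then show ?thesis
        unfolding linear_scale_sum[OF lin(2)] t_def .
    qed
    then show ?thesis
      unfolding tree_shuffle_def[of f g] by (simp only: L.sum L.scale scale_sum_right scale_scale)
  qed
  have rot: "t S T U = t T U S" for S T U
    unfolding t_def
    by (rule poly_mapping_eqI) (simp only: lookup_tree_shuffle_planar_shuffle card_triples_rotate[of S])
  have "tree_shuffle (tree_shuffle g h) f =
      (\<Sum>T\<in>Poly_Mapping.keys g. \<Sum>U\<in>Poly_Mapping.keys h. \<Sum>S\<in>Poly_Mapping.keys f.
        scale (?l f S * ?l g T * ?l h U) (t S T U))"
    unfolding expand by (simp only: rot mult_ac)
  also have "\<dots> = (\<Sum>T\<in>Poly_Mapping.keys g. \<Sum>S\<in>Poly_Mapping.keys f. \<Sum>U\<in>Poly_Mapping.keys h.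
        scale (?l f S * ?l g T * ?l h U) (t S T U))"
    by (intro sum.cong refl sum.swap)
  also have "\<dots> = tree_shuffle (tree_shuffle f g) h"
    unfolding expand by (rule sum.swap)
  finally show ?thesis by simp
qed

lemma tree_shuffle_assoc: "tree_shuffle (tree_shuffle f g) h = tree_shuffle f (tree_shuffle g h)"
  by (metis tree_shuffle_rotate tree_shuffle_commute)

theorem proposition3p3:
  shows "(\<exists>!B :: 'k::field tree_poly \<Rightarrow> 'k tree_poly \<Rightarrow> 'k tree_poly.
            bilinear_map B \<and>
            (\<forall>S T. B (tree_basis S) (tree_basis T) = planar_shuffle S T)) \<and>
         (\<forall>B :: 'k tree_poly \<Rightarrow> 'k tree_poly \<Rightarrow> 'k tree_poly.
            bilinear_map B \<and>
            (\<forall>S T. B (tree_basis S) (tree_basis T) = planar_shuffle S T) \<longrightarrow>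
            (\<forall>f g. B f g = B g f) \<and>
            (\<forall>f g h. B (B f g) h = B f (B g h)))"
proof -
  \<comment> \<open>The two requirements single out \<open>tree_shuffle\<close>, so existence,
    uniqueness and both laws become statements about this one map.\<close>
  have "bilinear_map B \<and> (\<forall>S T. B (tree_basis S) (tree_basis T) = planar_shuffle S T) \<longleftrightarrow>
      B = tree_shuffle" for B :: "'k tree_poly \<Rightarrow> 'k tree_poly \<Rightarrow> 'k tree_poly"
    using bilinear_tree_shuffle tree_shuffle_basis bilinear_map_unique by blast
  then show ?thesis
    by (simp add: tree_shuffle_assoc) (metis tree_shuffle_commute)
qed

end
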